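(* Let $\varphi_1$ and $\varphi_2$ be nonconstant inner functions in $H^{\infty}(\mathbb{D})$. Then the truncated Toeplitz operator $T^{\varphi_1}_{\varphi_2}$ on $\mathcal{Q}_{\varphi_1}$ is a partial isometry if and only if $\varphi_2$ divides $\varphi_1$ or $\varphi_1$ divides $\varphi_2$.
   Context: $\mathbb{D}$ is the open unit disc, $H^\infty(\mathbb{D})$ the algebra of bounded analytic functions on $\mathbb{D}$, and $H^2(\mathbb{D})$ the Hardy space on $\mathbb{D}$. A function $\varphi \in H^\infty(\mathbb{D})$ is inner if its radial boundary values satisfy $|\varphi| = 1$ almost everywhere on the unit circle. The model space of an inner function $\varphi$ is $\mathcal{Q}_\varphi = H^2(\mathbb{D}) \ominus \varphi H^2(\mathbb{D})$. For inner functions $\varphi_1, \varphi_2$, the truncated Toeplitz operator $T^{\varphi_1}_{\varphi_2} : \mathcal{Q}_{\varphi_1} \to \mathcal{Q}_{\varphi_1}$ is defined by $T^{\varphi_1}_{\varphi_2} f = P_{\mathcal{Q}_{\varphi_1}}(\varphi_2 f)$, where $P_{\mathcal{Q}_{\varphi_1}}$ is the orthogonal projection onto $\mathcal{Q}_{\varphi_1}$. A bounded operator $T$ is a partial isometry if $T|_{(\ker T)^\perp}$ is an isometry. For inner functions, $\varphi_1$ divides $\varphi_2$ if $\varphi_2 = \varphi \varphi_1$ for some $\varphi \in H^\infty(\mathbb{D})$. *)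

theory Defs
  imports "HOL-Complex_Analysis.Complex_Analysis"
begin

abbreviation unit_disc :: "complex set" where
  "unit_disc \<equiv> ball 0 1"

text \<open>Only the values on the disc matter here and in the definition of inner functions.\<close>

definition H_infinity :: "(complex \<Rightarrow> complex) set" where
  "H_infinity = {\<phi>. \<phi> holomorphic_on unit_disc \<and> bounded (\<phi> ` unit_disc)}"

definition inner_function :: "(complex \<Rightarrow> complex) \<Rightarrow> bool" where
  "inner_function \<phi> \<longleftrightarrow> \<phi> \<in> H_infinity \<and>
     (AE t in lborel. t \<in> {0..2*pi} \<longrightarrow>
        (\<exists>l. ((\<lambda>r. \<phi> (of_real r * cis t)) \<longlongrightarrow> l) (at_left 1) \<and> cmod l = 1))"

definition inner_divides :: "(complex \<Rightarrow> complex) \<Rightarrow> (complex \<Rightarrow> complex) \<Rightarrow> bool" where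
  "inner_divides \<phi>1 \<phi>2 \<longleftrightarrow> (\<exists>\<phi>\<in>H_infinity. \<forall>z\<in>unit_disc. \<phi>2 z = \<phi> z * \<phi>1 z)"

definition taylor_coeff :: "(complex \<Rightarrow> complex) \<Rightarrow> nat \<Rightarrow> complex" where
  "taylor_coeff f n = fps_nth (fps_expansion f 0) n"

text \<open>
  The Hardy space is the space of analytic functions on the disc with square-summable Taylor
  coefficients. Its elements are normalised to vanish off the disc, so that equality in the
  Hardy space is equality of HOL functions.
\<close>

definition H2 :: "(complex \<Rightarrow> complex) set" where
  "H2 = {f. f holomorphic_on unit_disc \<and> (\<forall>z. z \<notin> unit_disc \<longrightarrow> f z = 0) \<and>
            summable (\<lambda>n. (cmod (taylor_coeff f n))\<^sup>2)}"

definition H2_inner :: "(complex \<Rightarrow> complex) \<Rightarrow> (complex \<Rightarrow> complex) \<Rightarrow> complex" where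
  "H2_inner f g = (\<Sum>n. taylor_coeff f n * cnj (taylor_coeff g n))"

definition H2_norm :: "(complex \<Rightarrow> complex) \<Rightarrow> real" where
  "H2_norm f = sqrt (\<Sum>n. (cmod (taylor_coeff f n))\<^sup>2)"

definition model_space :: "(complex \<Rightarrow> complex) \<Rightarrow> (complex \<Rightarrow> complex) set" where
  "model_space \<phi> = {f \<in> H2. \<forall>g\<in>H2. H2_inner f (\<lambda>z. \<phi> z * g z) = 0}"

text \<open>
  The description below determines a unique element whenever \<open>S\<close> is a closed subspace of
  the Hardy space and \<open>f\<close> lies in the Hardy space; model spaces are closed.
\<close>

definition H2_proj :: "(complex \<Rightarrow> complex) set \<Rightarrow> (complex \<Rightarrow> complex) \<Rightarrow> (complex \<Rightarrow> complex)" where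
  "H2_proj S f = (THE g. g \<in> S \<and> (\<forall>h\<in>S. H2_inner (\<lambda>z. f z - g z) h = 0))"

definition truncated_Toeplitz ::
  "(complex \<Rightarrow> complex) \<Rightarrow> (complex \<Rightarrow> complex) \<Rightarrow> (complex \<Rightarrow> complex) \<Rightarrow> (complex \<Rightarrow> complex)" where
  "truncated_Toeplitz \<phi>1 \<phi>2 f = H2_proj (model_space \<phi>1) (\<lambda>z. \<phi>2 z * f z)"

definition bounded_operator_on ::
  "(complex \<Rightarrow> complex) set \<Rightarrow> ((complex \<Rightarrow> complex) \<Rightarrow> (complex \<Rightarrow> complex)) \<Rightarrow> bool" where
  "bounded_operator_on S T \<longleftrightarrow>
     (\<forall>f\<in>S. T f \<in> S) \<and>
     (\<forall>f\<in>S. \<forall>g\<in>S. T (\<lambda>z. f z + g z) = (\<lambda>z. T f z + T g z)) \<and>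
     (\<forall>c. \<forall>f\<in>S. T (\<lambda>z. c * f z) = (\<lambda>z. c * T f z)) \<and>
     (\<exists>B. \<forall>f\<in>S. H2_norm (T f) \<le> B * H2_norm f)"

definition operator_kernel ::
  "(complex \<Rightarrow> complex) set \<Rightarrow> ((complex \<Rightarrow> complex) \<Rightarrow> (complex \<Rightarrow> complex)) \<Rightarrow> (complex \<Rightarrow> complex) set" where
  "operator_kernel S T = {f \<in> S. T f = (\<lambda>z. 0)}"

definition orth_compl_in ::
  "(complex \<Rightarrow> complex) set \<Rightarrow> (complex \<Rightarrow> complex) set \<Rightarrow> (complex \<Rightarrow> complex) set" where
  "orth_compl_in S A = {f \<in> S. \<forall>g\<in>A. H2_inner f g = 0}"

definition partial_isometry_on ::
  "(complex \<Rightarrow> complex) set \<Rightarrow> ((complex \<Rightarrow> complex) \<Rightarrow> (complex \<Rightarrow> complex)) \<Rightarrow> bool" where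
  "partial_isometry_on S T \<longleftrightarrow> bounded_operator_on S T \<and>
     (\<forall>f\<in>orth_compl_in S (operator_kernel S T). H2_norm (T f) = H2_norm f)"

end

theory Submission
  imports Defs
begin

text \<open>
An element of the Hardy space is its sequence of Taylor coefficients, and products of functions are
products of power series. The argument therefore takes place in the ring of formal power series,
inside the Hilbert space \<open>l2\<close> of those with square-summable coefficients; multiplication by
\<open>fps_X\<close> is the unilateral shift. An inner function becomes an \<^emph>\<open>isometric multiplier\<close>
(lemma \<open>inner_imp_isometric\<close>): the norm of \<open>l2\<close> is the limit of the means over circles of
radius \<open>r\<close> tending to 1, and an inner function has modulus 1 in that limit. Conversely, isometric
multipliers are bounded by 1 on the disc, so two inner functions whose quotient lies in the Hardy
space have a bounded quotient, and divisibility can be tested in \<open>l2\<close> (\<open>inner_divides_iff\<close>).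

For an isometric multiplier \<open>u\<close> with adjoint \<open>u*\<close>, the operator \<open>E u = u u*\<close> is the orthogonal
projection onto the range of \<open>u\<close>, and the model space of \<open>u\<close> is its null space. The truncated Toeplitz
operator is \<open>T f = (1 - E u) (v f)\<close>, whose adjoint on the model space is the restriction of \<open>v*\<close>.

Suppose that \<open>T\<close> is a partial isometry, and let \<open>g\<close> belong to the model space. Then \<open>v* g\<close> is
orthogonal to the kernel of \<open>T\<close>, so \<open>T\<close> preserves its norm, and so does \<open>v\<close>. Hence the projection
\<open>1 - E u\<close> preserves the norm of \<open>E v g\<close>, which forces \<open>E u (E v g) = 0\<close>. Taking adjoints, \<open>E u\<close> and
\<open>E v\<close> commute (\<open>range_projs_commute\<close>). Commuting range projections imply divisibility
(\<open>divides_if_range_projs_commute\<close>). With \<open>S\<close> the shift, \<open>E u f = S (E u (S* f)) + <f,u> u\<close>. Expanding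
\<open>E v (E u f) = E u (E v f)\<close> with this rule shows that \<open>E u v\<close> is a combination of \<open>u\<close> and \<open>v\<close>. If the
coefficient of \<open>v\<close> is not 0, then \<open>u\<close> divides \<open>v\<close>; otherwise \<open>E u v = <v,u> u\<close>. If divisibility fails
both ways, the same holds with the roles exchanged, commutation forces \<open><v,u> = 0\<close>, and then the ranges of
\<open>u\<close> and \<open>v\<close> are orthogonal, although both contain \<open>u v\<close>.

For the converse, \<open>T = 0\<close> if \<open>u\<close> divides \<open>v\<close>. If \<open>u = v w\<close>, then the orthogonal complement of the kernel
of \<open>T\<close> consists of elements of the model space of \<open>w\<close>. Multiplication by \<open>v\<close> maps these into the
model space of \<open>u\<close>, so there \<open>T\<close> is multiplication by \<open>v\<close>, an isometry
(\<open>isometric_off_kernel_mult\<close>).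
\<close>

section \<open>Square-summable coefficient sequences\<close>

text \<open>
The elements are formal power series rather than functions on the natural numbers, so that the
product of the ring is the product of the analytic functions that they represent.
\<close>

definition l2 :: "complex fps set" where
  "l2 = {f. summable (\<lambda>n. (cmod (fps_nth f n))\<^sup>2)}"

definition ip :: "complex fps \<Rightarrow> complex fps \<Rightarrow> complex" where
  "ip f g = (\<Sum>n. fps_nth f n * cnj (fps_nth g n))"

definition nrm :: "complex fps \<Rightarrow> real" where
  "nrm f = sqrt (\<Sum>n. (cmod (fps_nth f n))\<^sup>2)"

lemma l2_add: assumes "f \<in> l2" "g \<in> l2" shows "f + g \<in> l2"
proof -
  have "(cmod (a + b))\<^sup>2 \<le> 2 * (cmod a)\<^sup>2 + 2 * (cmod b)\<^sup>2" for a b :: complex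
  proof -
    have "(cmod (a + b))\<^sup>2 \<le> (cmod a + cmod b)\<^sup>2"
      by (intro power_mono norm_triangle_ineq) auto
    also have "\<dots> \<le> 2 * (cmod a)\<^sup>2 + 2 * (cmod b)\<^sup>2"
      using zero_le_power2[of "cmod a - cmod b"] by (simp add: power2_eq_square algebra_simps)
    finally show ?thesis .
  qed
  note le = this
  have S: "summable (\<lambda>n. 2 * (cmod (fps_nth f n))\<^sup>2 + 2 * (cmod (fps_nth g n))\<^sup>2)"
    using assms by (intro summable_add summable_mult) (auto simp: l2_def)
  have "summable (\<lambda>n. (cmod (fps_nth (f + g) n))\<^sup>2)"
    by (rule summable_comparison_test'[OF S, where N = 0]) (auto simp: le)
  then show ?thesis by (simp add: l2_def)
qed

lemma l2_scale: "f \<in> l2 \<Longrightarrow> fps_const c * f \<in> l2"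
  by (auto simp: l2_def norm_mult power_mult_distrib intro: summable_mult)

lemma l2_minus: "f \<in> l2 \<Longrightarrow> - f \<in> l2"
  by (auto simp: l2_def)

lemma l2_diff: "f \<in> l2 \<Longrightarrow> g \<in> l2 \<Longrightarrow> f - g \<in> l2"
  using l2_add[of f "- g"] l2_minus[of g] by simp

lemma l2_0 [simp]: "0 \<in> l2"
  by (simp add: l2_def)

lemma l2_X: "f \<in> l2 \<Longrightarrow> fps_X * f \<in> l2"
  unfolding l2_def mem_Collect_eq
  by (subst summable_Suc_iff[symmetric]) simp

lemma l2_X_power: "f \<in> l2 \<Longrightarrow> fps_X ^ n * f \<in> l2"
  by (induction n) (auto simp: mult.assoc intro: l2_X)

lemma l2_shift: "f \<in> l2 \<Longrightarrow> fps_shift 1 f \<in> l2"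
  using summable_Suc_iff[of "\<lambda>n. (cmod (fps_nth f n))\<^sup>2"] by (simp add: l2_def)

lemma l2_finite_support: assumes "\<And>n. n \<ge> N \<Longrightarrow> fps_nth f n = 0" shows "f \<in> l2"
  unfolding l2_def mem_Collect_eq
  by (rule summable_finite[of "{..<N}"]) (use assms in \<open>auto simp: not_less\<close>)

lemma l2_const [simp]: "fps_const c \<in> l2"
  by (rule l2_finite_support[of 1]) auto

lemma l2_1 [simp]: "1 \<in> l2"
  using l2_const[of 1] by simp

lemma l2_cutoff [simp]: "fps_cutoff N f \<in> l2"
  by (rule l2_finite_support[of N]) auto

lemma abs_summable_ip:
  assumes "f \<in> l2" "g \<in> l2"
  shows "summable (\<lambda>n. cmod (fps_nth f n * cnj (fps_nth g n)))"
proof -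
  have "a * b \<le> a\<^sup>2 + b\<^sup>2" for a b :: real
    using zero_le_power2[of "a - b"] zero_le_power2[of "a + b"]
    by (simp add: power2_eq_square algebra_simps)
  note le = this
  have S: "summable (\<lambda>n. (cmod (fps_nth f n))\<^sup>2 + (cmod (fps_nth g n))\<^sup>2)"
    using assms by (intro summable_add) (auto simp: l2_def)
  show ?thesis
    by (rule summable_comparison_test'[OF S, where N = 0]) (auto simp: norm_mult le)
qed

lemma summable_ip:
  "f \<in> l2 \<Longrightarrow> g \<in> l2 \<Longrightarrow> summable (\<lambda>n. fps_nth f n * cnj (fps_nth g n))"
  by (rule summable_norm_cancel) (rule abs_summable_ip)

lemma ip_add_left: "f \<in> l2 \<Longrightarrow> g \<in> l2 \<Longrightarrow> h \<in> l2 \<Longrightarrow> ip (f + g) h = ip f h + ip g h"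
  unfolding ip_def by (subst suminf_add) (auto intro: summable_ip simp: algebra_simps)

lemma ip_scale_left: "f \<in> l2 \<Longrightarrow> g \<in> l2 \<Longrightarrow> ip (fps_const c * f) g = c * ip f g"
  unfolding ip_def by (subst suminf_mult[symmetric]) (auto intro: summable_ip simp: algebra_simps)

lemma ip_cnj: assumes "f \<in> l2" "g \<in> l2" shows "cnj (ip f g) = ip g f"
proof -
  have "(\<lambda>n. fps_nth f n * cnj (fps_nth g n)) sums ip f g"
    using summable_ip[OF assms] unfolding ip_def by (rule summable_sums)
  then have "(\<lambda>n. cnj (fps_nth f n * cnj (fps_nth g n))) sums cnj (ip f g)"
    by (simp only: sums_cnj)
  then show ?thesis unfolding ip_def by (simp add: sums_iff mult.commute)
qed

lemma ip_minus_left: "f \<in> l2 \<Longrightarrow> g \<in> l2 \<Longrightarrow> ip (- f) g = - ip f g"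
  using ip_scale_left[of f g "-1"] by (simp flip: fps_const_neg)

lemma ip_diff_left: "f \<in> l2 \<Longrightarrow> g \<in> l2 \<Longrightarrow> h \<in> l2 \<Longrightarrow> ip (f - g) h = ip f h - ip g h"
  using ip_add_left[of f "- g" h] by (simp add: l2_minus ip_minus_left)

lemma ip_add_right: "f \<in> l2 \<Longrightarrow> g \<in> l2 \<Longrightarrow> h \<in> l2 \<Longrightarrow> ip h (f + g) = ip h f + ip h g"
  by (metis complex_cnj_add ip_add_left ip_cnj l2_add)

lemma ip_diff_right: "f \<in> l2 \<Longrightarrow> g \<in> l2 \<Longrightarrow> h \<in> l2 \<Longrightarrow> ip h (f - g) = ip h f - ip h g"
  by (metis complex_cnj_diff ip_diff_left ip_cnj l2_diff)

lemma ip_scale_right: "f \<in> l2 \<Longrightarrow> g \<in> l2 \<Longrightarrow> ip f (fps_const c * g) = cnj c * ip f g"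
  by (metis complex_cnj_mult ip_scale_left ip_cnj l2_scale)

lemma ip_0_left [simp]: "ip 0 f = 0" and ip_0_right [simp]: "ip f 0 = 0"
  by (simp_all add: ip_def)

lemma nrm_nonneg: "f \<in> l2 \<Longrightarrow> nrm f \<ge> 0"
  by (auto simp: nrm_def l2_def suminf_nonneg)

lemma nrm_sqr: "f \<in> l2 \<Longrightarrow> (nrm f)\<^sup>2 = (\<Sum>n. (cmod (fps_nth f n))\<^sup>2)"
  by (auto simp: nrm_def l2_def suminf_nonneg)

lemma ip_self: assumes "f \<in> l2" shows "ip f f = of_real ((nrm f)\<^sup>2)"
proof -
  have "(\<lambda>n. of_real ((cmod (fps_nth f n))\<^sup>2)) sums (of_real ((nrm f)\<^sup>2) :: complex)"
    using assms by (intro sums_of_real) (auto simp: nrm_sqr l2_def summable_sums)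
  then show ?thesis
    unfolding ip_def by (simp add: sums_iff flip: complex_norm_square)
qed

lemma nrm_cutoff_sqr: "(nrm (fps_cutoff N f))\<^sup>2 = (\<Sum>n<N. (cmod (fps_nth f n))\<^sup>2)"
proof -
  have "(\<Sum>n. (cmod (fps_nth (fps_cutoff N f) n))\<^sup>2) = (\<Sum>n<N. (cmod (fps_nth (fps_cutoff N f) n))\<^sup>2)"
    by (rule suminf_finite) auto
  then show ?thesis by (simp add: nrm_sqr)
qed

lemma nrm_cutoff_le: assumes "f \<in> l2" shows "nrm (fps_cutoff N f) \<le> nrm f"
proof -
  have "(nrm (fps_cutoff N f))\<^sup>2 \<le> (nrm f)\<^sup>2"
    unfolding nrm_cutoff_sqr nrm_sqr[OF assms] using assms
    by (intro sum_le_suminf) (auto simp: l2_def)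
  then show ?thesis using nrm_nonneg[OF assms] by (rule power2_le_imp_le)
qed

lemma nrm_cutoff_tendsto: assumes "f \<in> l2" shows "(\<lambda>N. nrm (fps_cutoff N f)) \<longlonglongrightarrow> nrm f"
proof -
  have "(\<lambda>N. (nrm (fps_cutoff N f))\<^sup>2) \<longlonglongrightarrow> (nrm f)\<^sup>2"
    unfolding nrm_cutoff_sqr nrm_sqr[OF assms] using assms
    by (intro summable_LIMSEQ) (auto simp: l2_def)
  then have "(\<lambda>N. sqrt ((nrm (fps_cutoff N f))\<^sup>2)) \<longlonglongrightarrow> sqrt ((nrm f)\<^sup>2)"
    by (rule tendsto_real_sqrt)
  then show ?thesis using assms by (simp add: nrm_nonneg)
qed

lemma nth_le_nrm: assumes "f \<in> l2" shows "cmod (fps_nth f n) \<le> nrm f"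
proof -
  have "(cmod (fps_nth f n))\<^sup>2 \<le> (nrm (fps_cutoff (Suc n) f))\<^sup>2"
    unfolding nrm_cutoff_sqr by (simp add: sum_nonneg)
  then have "cmod (fps_nth f n) \<le> nrm (fps_cutoff (Suc n) f)"
    by (rule power2_le_imp_le) (simp add: nrm_nonneg)
  then show ?thesis using nrm_cutoff_le[OF assms, of "Suc n"] by simp
qed

lemma nrm_eq_0D: "f \<in> l2 \<Longrightarrow> nrm f = 0 \<Longrightarrow> f = 0"
  using nth_le_nrm[of f] by (auto intro!: fps_ext)

lemma ip_self_eq_0D: "f \<in> l2 \<Longrightarrow> ip f f = 0 \<Longrightarrow> f = 0"
  by (rule nrm_eq_0D) (auto simp: ip_self)

lemma l2_if_cutoff_bounded:
  assumes "\<And>N. nrm (fps_cutoff N f) \<le> C"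
  shows "f \<in> l2" "nrm f \<le> C"
proof -
  have C: "(\<Sum>n<N. (cmod (fps_nth f n))\<^sup>2) \<le> C\<^sup>2" for N
    unfolding nrm_cutoff_sqr[symmetric] using assms[of N]
    by (intro power_mono) (auto simp: nrm_nonneg)
  then show f: "f \<in> l2"
    unfolding l2_def by (auto intro!: summableI_nonneg_bounded)
  show "nrm f \<le> C"
    using nrm_cutoff_tendsto[OF f] assms by (intro LIMSEQ_le_const2) auto
qed

lemma Cauchy_Schwarz: assumes f: "f \<in> l2" and g: "g \<in> l2" shows "cmod (ip f g) \<le> nrm f * nrm g"
proof (rule LIMSEQ_le_const2)
  show "(\<lambda>N. cmod (\<Sum>n<N. fps_nth f n * cnj (fps_nth g n))) \<longlonglongrightarrow> cmod (ip f g)"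
    unfolding ip_def by (intro tendsto_norm summable_LIMSEQ summable_ip f g)
  have "cmod (\<Sum>n<N. fps_nth f n * cnj (fps_nth g n)) \<le> nrm f * nrm g" for N
  proof -
    have nrm_L2: "L2_set (\<lambda>n. cmod (fps_nth h n)) {..<N} = nrm (fps_cutoff N h)" for h
      using nrm_cutoff_sqr[of N h] by (simp add: L2_set_def real_sqrt_unique nrm_nonneg)
    have "cmod (\<Sum>n<N. fps_nth f n * cnj (fps_nth g n)) \<le>
          (\<Sum>n<N. \<bar>cmod (fps_nth f n)\<bar> * \<bar>cmod (fps_nth g n)\<bar>)"
      by (rule order_trans[OF norm_sum]) (simp add: norm_mult)
    also have "\<dots> \<le> nrm (fps_cutoff N f) * nrm (fps_cutoff N g)"
      using L2_set_mult_ineq[of "\<lambda>n. cmod (fps_nth f n)" "\<lambda>n. cmod (fps_nth g n)" "{..<N}"]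
      by (simp only: nrm_L2)
    also have "\<dots> \<le> nrm f * nrm g"
      by (intro mult_mono nrm_cutoff_le f g nrm_nonneg l2_cutoff)
    finally show ?thesis .
  qed
  then show "\<exists>N0. \<forall>N\<ge>N0. cmod (\<Sum>n<N. fps_nth f n * cnj (fps_nth g n)) \<le> nrm f * nrm g"
    by blast
qed

lemma nrm_add_sqr:
  assumes "f \<in> l2" "g \<in> l2"
  shows "(nrm (f + g))\<^sup>2 = (nrm f)\<^sup>2 + 2 * Re (ip f g) + (nrm g)\<^sup>2"
proof -
  have "Re (ip (f + g) (f + g)) = Re (ip f f) + Re (ip f g) + Re (ip g f) + Re (ip g g)"
    using assms by (simp add: ip_add_left ip_add_right l2_add)
  moreover have "Re (ip g f) = Re (ip f g)"
    using ip_cnj[OF assms] by (metis cnj.simps(1))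
  ultimately show ?thesis using assms by (simp add: ip_self l2_add)
qed

lemma nrm_triangle: assumes "f \<in> l2" "g \<in> l2" shows "nrm (f + g) \<le> nrm f + nrm g"
proof (rule power2_le_imp_le)
  have "Re (ip f g) \<le> nrm f * nrm g"
    using Cauchy_Schwarz[OF assms] complex_Re_le_cmod[of "ip f g"] by linarith
  then show "(nrm (f + g))\<^sup>2 \<le> (nrm f + nrm g)\<^sup>2"
    by (simp add: nrm_add_sqr[OF assms] power2_sum)
qed (use assms in \<open>simp add: nrm_nonneg\<close>)

text \<open>
A truncation is orthogonal to its remainder, so the square of the norm of the remainder is the
difference of two squares that have the same limit.
\<close>

lemma cutoff_remainder_tendsto:
  assumes f: "f \<in> l2" shows "(\<lambda>N. nrm (f - fps_cutoff N f)) \<longlonglongrightarrow> 0"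
proof -
  have "(nrm (f - fps_cutoff N f))\<^sup>2 = (nrm f)\<^sup>2 - (nrm (fps_cutoff N f))\<^sup>2" for N
  proof -
    have "ip (fps_cutoff N f) (f - fps_cutoff N f) = 0"
      unfolding ip_def by (rule trans[OF suminf_cong suminf_zero]) auto
    then show ?thesis
      using nrm_add_sqr[of "fps_cutoff N f" "f - fps_cutoff N f"] by (simp add: f l2_diff)
  qed
  moreover have "(\<lambda>N. (nrm f)\<^sup>2 - (nrm (fps_cutoff N f))\<^sup>2) \<longlonglongrightarrow> (nrm f)\<^sup>2 - (nrm f)\<^sup>2"
    by (intro tendsto_intros nrm_cutoff_tendsto f)
  ultimately have "(\<lambda>N. sqrt ((nrm (f - fps_cutoff N f))\<^sup>2)) \<longlonglongrightarrow> sqrt 0"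
    by (intro tendsto_real_sqrt) simp
  then show ?thesis using f by (simp add: nrm_nonneg l2_diff)
qed

lemma nrm_X: assumes "f \<in> l2" shows "nrm (fps_X * f) = nrm f"
  using suminf_split_head[of "\<lambda>n. (cmod (fps_nth (fps_X * f) n))\<^sup>2"] l2_X[OF assms]
  by (simp add: nrm_def l2_def)

lemma ip_X_right:
  assumes "f \<in> l2" "g \<in> l2" shows "ip f (fps_X * g) = ip (fps_shift 1 f) g"
  using suminf_split_head[OF summable_ip[OF assms(1) l2_X[OF assms(2)]]]
  by (simp add: ip_def)

lemma cutoff_sum: "fps_cutoff N f = (\<Sum>n<N. fps_const (fps_nth f n) * fps_X ^ n)"
  by (rule fps_ext) (auto simp: fps_sum_nth if_distrib cong: if_cong)

lemma ip_1_right: "ip f 1 = fps_nth f 0"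
  unfolding ip_def by (subst suminf_finite[of "{0}"]) auto

section \<open>Isometric multipliers and their adjoints\<close>

definition isometric :: "complex fps \<Rightarrow> bool" where
  "isometric u \<longleftrightarrow> (\<forall>f\<in>l2. u * f \<in> l2 \<and> nrm (u * f) = nrm f)"

lemma isometric_l2: "isometric u \<Longrightarrow> f \<in> l2 \<Longrightarrow> u * f \<in> l2"
  by (simp add: isometric_def)

lemma isometric_nrm: "isometric u \<Longrightarrow> f \<in> l2 \<Longrightarrow> nrm (u * f) = nrm f"
  by (simp add: isometric_def)

lemma isometric_in_l2: "isometric u \<Longrightarrow> u \<in> l2"
  using isometric_l2[of u 1] by simp

text \<open>
The coefficients of \<open>u * f\<close> up to a given index depend only on a truncation of \<open>f\<close>, so the
truncations of \<open>u * f\<close> have norm at most \<open>nrm f\<close>, and \<open>u\<close> is contractive. The reverse estimate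
follows from the triangle inequality, as the contraction sends the remainders of \<open>f\<close> to elements
whose norms tend to 0.
\<close>

lemma isometric_if_isometric_on_polynomials:
  assumes l2: "\<And>N f. u * fps_cutoff N f \<in> l2"
    and nrm: "\<And>N f. nrm (u * fps_cutoff N f) = nrm (fps_cutoff N f)"
  shows "isometric u"
  unfolding isometric_def
proof
  fix f assume f: "f \<in> l2"
  (* Stated for all g, as it is also applied to the remainders of f. *)
  have bound: "u * g \<in> l2 \<and> nrm (u * g) \<le> nrm g" if g: "g \<in> l2" for g
  proof -
    have "fps_cutoff N (u * g) = fps_cutoff N (u * fps_cutoff N g)" for N
      by (rule fps_ext) (auto simp: fps_mult_nth intro!: sum.cong)
    then have "nrm (fps_cutoff N (u * g)) \<le> nrm g" for N
      using nrm_cutoff_le[OF l2[of N g], of N] nrm_cutoff_le[OF g, of N] by (simp add: nrm)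
    from l2_if_cutoff_bounded[OF this] show ?thesis by simp
  qed
  have "nrm f - 0 \<le> nrm (u * f)"
  proof (rule LIMSEQ_le_const2)
    show "(\<lambda>N. nrm (fps_cutoff N f) - nrm (f - fps_cutoff N f)) \<longlonglongrightarrow> nrm f - 0"
      by (intro tendsto_diff nrm_cutoff_tendsto cutoff_remainder_tendsto f)
    have "nrm (fps_cutoff N f) - nrm (f - fps_cutoff N f) \<le> nrm (u * f)" for N
    proof -
      let ?r = "fps_cutoff N f - f"
      have r: "?r \<in> l2" using f by (simp add: l2_diff)
      have "nrm (fps_cutoff N f) = nrm (u * f + u * ?r)"
        by (subst nrm[symmetric]) (simp add: algebra_simps)
      also have "\<dots> \<le> nrm (u * f) + nrm ?r"
        using nrm_triangle[of "u * f" "u * ?r"] bound[OF f] bound[OF r] by auto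
      also have "nrm ?r = nrm (f - fps_cutoff N f)"
        by (simp add: nrm_def norm_minus_commute)
      finally show ?thesis by simp
    qed
    then show "\<exists>M. \<forall>N\<ge>M. nrm (fps_cutoff N f) - nrm (f - fps_cutoff N f) \<le> nrm (u * f)"
      by blast
  qed
  then show "u * f \<in> l2 \<and> nrm (u * f) = nrm f"
    using bound[OF f] by auto
qed

text \<open>
Since \<open>l2\<close> is invariant under the shift, \<open>w\<close> multiplies polynomials into \<open>l2\<close>; on them its norm
identity is that of \<open>v\<close>, with the isometry \<open>u\<close> cancelled.
\<close>

lemma isometric_quotient:
  assumes "isometric u" "isometric v" "v = u * w" "w \<in> l2"
  shows "isometric w"
proof (rule isometric_if_isometric_on_polynomials)
  fix N :: nat and f :: "complex fps"
  have sum_l2: "(\<Sum>n<M. fps_const (fps_nth f n) * (fps_X ^ n * w)) \<in> l2" for M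
    by (induction M) (auto intro!: l2_add l2_scale l2_X_power assms)
  show l2: "w * fps_cutoff N f \<in> l2"
    using sum_l2[of N] by (simp add: cutoff_sum sum_distrib_left mult_ac)
  show "nrm (w * fps_cutoff N f) = nrm (fps_cutoff N f)"
    using isometric_nrm[OF assms(1) l2] isometric_nrm[OF assms(2), of "fps_cutoff N f"]
    by (simp add: assms(3) mult.assoc)
qed

text \<open>
Polarization: the real part of the inner product is read off from the norm of a sum, and the
imaginary part is the real part after multiplying one argument by \<open>\<i>\<close>.
\<close>

lemma isometric_ip:
  assumes u: "isometric u" and f: "f \<in> l2" and g: "g \<in> l2"
  shows "ip (u * f) (u * g) = ip f g"
proof -
  have Re: "Re (ip (u * f) (u * g)) = Re (ip f g)" if g: "g \<in> l2" for g
  proof -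
    have "(nrm (u * f + u * g))\<^sup>2 = (nrm (f + g))\<^sup>2"
      using isometric_nrm[OF u l2_add[OF f g]] by (simp add: algebra_simps)
    then show ?thesis
      using f g by (simp add: nrm_add_sqr isometric_l2[OF u] isometric_nrm[OF u])
  qed
  have "Im (ip (u * f) (u * g)) = Re (ip (u * f) (u * (fps_const \<i> * g)))"
    using ip_scale_right[OF isometric_l2[OF u f] isometric_l2[OF u g], of \<i>]
    by (simp add: mult.left_commute)
  also have "\<dots> = Re (ip f (fps_const \<i> * g))"
    using g by (intro Re l2_scale)
  also have "\<dots> = Im (ip f g)"
    using f g by (simp add: ip_scale_right)
  finally show ?thesis using Re[OF g] by (simp add: complex_eq_iff)
qed

text \<open>
The Hilbert space adjoint of multiplication by \<open>u\<close>, as \<open>ip_mult_right\<close> shows. The explicit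
coefficients stand in for an appeal to the Riesz representation theorem.
\<close>

definition adj :: "complex fps \<Rightarrow> complex fps \<Rightarrow> complex fps" where
  "adj u f = Abs_fps (\<lambda>n. ip f (u * fps_X ^ n))"

lemma ip_mult_cutoff:
  assumes u: "isometric u" and f: "f \<in> l2"
  shows "ip f (u * fps_cutoff N g) = (\<Sum>n<N. fps_nth (adj u f) n * cnj (fps_nth g n))"
proof -
  have X: "u * fps_X ^ n \<in> l2" for n
    using l2_X_power[OF l2_1, of n] by (simp add: isometric_l2[OF u])
  have "(\<Sum>n<N. fps_const (fps_nth g n) * (u * fps_X ^ n)) \<in> l2 \<and>
    ip f (\<Sum>n<N. fps_const (fps_nth g n) * (u * fps_X ^ n)) = (\<Sum>n<N. cnj (fps_nth g n) * ip f (u * fps_X ^ n))"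
    by (induction N) (auto simp: l2_add l2_scale X f ip_add_right ip_scale_right)
  then show ?thesis
    by (simp add: cutoff_sum sum_distrib_left adj_def mult_ac)
qed

text \<open>
Bessel's inequality for the orthonormal system \<open>u * fps_X ^ n\<close>: pair \<open>f\<close> with \<open>u * p\<close>, where \<open>p\<close>
is a truncation of \<open>adj u f\<close>, and apply the Cauchy-Schwarz inequality.
\<close>

lemma adj_l2:
  assumes u: "isometric u" and f: "f \<in> l2"
  shows "adj u f \<in> l2"
proof -
  have "nrm (fps_cutoff N (adj u f)) \<le> nrm f" for N
  proof -
    let ?p = "fps_cutoff N (adj u f)"
    have "ip f (u * ?p) = of_real ((nrm ?p)\<^sup>2)"
      using ip_mult_cutoff[OF u f, of N "adj u f"] unfolding nrm_cutoff_sqr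
      by (simp flip: complex_norm_square)
    then have "(nrm ?p)\<^sup>2 \<le> nrm f * nrm ?p"
      using Cauchy_Schwarz[OF f isometric_l2[OF u l2_cutoff], of N "adj u f"]
      by (simp add: isometric_nrm[OF u] norm_power)
    then show ?thesis
      using nrm_nonneg[OF f] nrm_nonneg[OF l2_cutoff, of N "adj u f"]
      by (cases "nrm ?p = 0") (auto simp: power2_eq_square)
  qed
  then show ?thesis by (rule l2_if_cutoff_bounded)
qed

text \<open>
For truncations of \<open>g\<close> this is the definition of the adjoint; both sides are continuous in \<open>g\<close>.
\<close>

lemma ip_mult_right:
  assumes u: "isometric u" and f: "f \<in> l2" and g: "g \<in> l2"
  shows "ip f (u * g) = ip (adj u f) g"
proof (rule LIMSEQ_unique)
  have "(\<lambda>N. ip f (u * g) - ip f (u * fps_cutoff N g)) \<longlonglongrightarrow> 0"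
  proof (rule tendsto_0_le)
    show "(\<lambda>N. nrm f * nrm (g - fps_cutoff N g)) \<longlonglongrightarrow> 0"
      using cutoff_remainder_tendsto[OF g] by (rule tendsto_mult_right_zero)
    have "norm (ip f (u * g) - ip f (u * fps_cutoff N g)) \<le> nrm f * nrm (g - fps_cutoff N g)" for N
    proof -
      let ?r = "g - fps_cutoff N g"
      have r: "?r \<in> l2" using g by (simp add: l2_diff)
      have "ip f (u * g) - ip f (u * fps_cutoff N g) = ip f (u * ?r)"
        using f g by (simp add: right_diff_distrib ip_diff_right isometric_l2[OF u])
      then show ?thesis
        using Cauchy_Schwarz[OF f isometric_l2[OF u r]] by (simp add: isometric_nrm[OF u r])
    qed
    then show "\<forall>\<^sub>F N in sequentially. norm (ip f (u * g) - ip f (u * fps_cutoff N g))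
        \<le> norm (nrm f * nrm (g - fps_cutoff N g)) * 1"
      by (intro always_eventually allI) (auto intro: order_trans[OF _ abs_ge_self])
  qed
  from tendsto_diff[OF tendsto_const[of "ip f (u * g)"] this]
  show "(\<lambda>N. ip f (u * fps_cutoff N g)) \<longlonglongrightarrow> ip f (u * g)"
    by simp
  show "(\<lambda>N. ip f (u * fps_cutoff N g)) \<longlonglongrightarrow> ip (adj u f) g"
    unfolding ip_mult_cutoff[OF u f] ip_def[of "adj u f"]
    by (intro summable_LIMSEQ summable_ip adj_l2 u f g)
qed

lemma ip_mult_left:
  assumes u: "isometric u" and f: "f \<in> l2" and g: "g \<in> l2"
  shows "ip (u * f) g = ip f (adj u g)"
  by (metis adj_l2 f g ip_cnj ip_mult_right isometric_l2 u)

lemma l2_eqI: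
  assumes "f \<in> l2" "g \<in> l2" "\<And>h. h \<in> l2 \<Longrightarrow> ip f h = ip g h"
  shows "f = g"
  using ip_self_eq_0D[of "f - g"] assms by (simp add: l2_diff ip_diff_left)

lemma adj_mult: "isometric u \<Longrightarrow> f \<in> l2 \<Longrightarrow> adj u (u * f) = f"
  by (rule l2_eqI) (auto simp: adj_l2 isometric_l2 isometric_ip simp flip: ip_mult_right)

lemma adj_add: "isometric u \<Longrightarrow> f \<in> l2 \<Longrightarrow> g \<in> l2 \<Longrightarrow> adj u (f + g) = adj u f + adj u g"
  by (rule fps_ext) (simp add: adj_def ip_add_left isometric_l2 l2_X_power[of 1, simplified])

lemma adj_diff: "isometric u \<Longrightarrow> f \<in> l2 \<Longrightarrow> g \<in> l2 \<Longrightarrow> adj u (f - g) = adj u f - adj u g"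
  by (rule fps_ext) (simp add: adj_def ip_diff_left isometric_l2 l2_X_power[of 1, simplified])

lemma adj_scale: "isometric u \<Longrightarrow> f \<in> l2 \<Longrightarrow> adj u (fps_const c * f) = fps_const c * adj u f"
  by (rule fps_ext) (simp add: adj_def ip_scale_left isometric_l2 l2_X_power[of 1, simplified])

lemma adj_0 [simp]: "adj u 0 = 0"
  by (rule fps_ext) (simp add: adj_def)

section \<open>Commuting range projections and divisibility\<close>

text \<open>
The orthogonal projection onto the range of multiplication by the isometric multiplier \<open>u\<close>.
\<close>

definition range_proj :: "complex fps \<Rightarrow> complex fps \<Rightarrow> complex fps" where
  "range_proj u f = u * adj u f"

lemma range_proj_l2: "isometric u \<Longrightarrow> f \<in> l2 \<Longrightarrow> range_proj u f \<in> l2"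
  by (simp add: range_proj_def isometric_l2 adj_l2)

lemma range_proj_sym:
  "isometric u \<Longrightarrow> f \<in> l2 \<Longrightarrow> g \<in> l2 \<Longrightarrow> ip (range_proj u f) g = ip f (range_proj u g)"
  by (simp add: range_proj_def ip_mult_left ip_mult_right adj_l2)

lemma range_proj_add: "isometric u \<Longrightarrow> f \<in> l2 \<Longrightarrow> g \<in> l2 \<Longrightarrow>
    range_proj u (f + g) = range_proj u f + range_proj u g"
  by (simp add: range_proj_def adj_add distrib_left)

lemma range_proj_diff: "isometric u \<Longrightarrow> f \<in> l2 \<Longrightarrow> g \<in> l2 \<Longrightarrow>
    range_proj u (f - g) = range_proj u f - range_proj u g"
  by (simp add: range_proj_def adj_diff right_diff_distrib)

lemma range_proj_scale: "isometric u \<Longrightarrow> f \<in> l2 \<Longrightarrow>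
    range_proj u (fps_const c * f) = fps_const c * range_proj u f"
  by (simp add: range_proj_def adj_scale mult.left_commute)

lemma range_proj_mult: "isometric u \<Longrightarrow> f \<in> l2 \<Longrightarrow> range_proj u (u * f) = u * f"
  by (simp add: range_proj_def adj_mult)

lemma range_proj_self: "isometric u \<Longrightarrow> range_proj u u = u"
  using range_proj_mult[of u 1] by simp

text \<open>
By \<open>ip_X_right\<close>, the pairing of \<open>f\<close> with \<open>u * fps_X ^ Suc m\<close> is that of the shifted-down \<open>f\<close>
with \<open>u * fps_X ^ m\<close>; only the coefficient of index 0 is new.
\<close>

lemma adj_shift:
  assumes u: "isometric u" and f: "f \<in> l2"
  shows "adj u f = fps_X * adj u (fps_shift 1 f) + fps_const (ip f u)"
proof (rule fps_ext)
  fix n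
  have "ip f (u * fps_X ^ Suc m) = ip (fps_shift 1 f) (u * fps_X ^ m)" for m
  proof -
    have "u * fps_X ^ m \<in> l2"
      using isometric_l2[OF u l2_X_power[OF l2_1]] by simp
    from ip_X_right[OF f this] show ?thesis by (simp add: mult_ac)
  qed
  then show "fps_nth (adj u f) n = fps_nth (fps_X * adj u (fps_shift 1 f) + fps_const (ip f u)) n"
    by (cases n) (auto simp: adj_def)
qed

lemma range_proj_shift:
  assumes "isometric u" "f \<in> l2"
  shows "range_proj u f = fps_X * range_proj u (fps_shift 1 f) + fps_const (ip f u) * u"
  unfolding range_proj_def by (subst adj_shift[OF assms]) (simp add: algebra_simps)

text \<open>
Two applications of \<open>range_proj_shift\<close>. The first summand is conjugation by the shift. If the
projections commute, it is unchanged when \<open>u\<close> and \<open>v\<close> are exchanged, so that the two remaining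
summands, built from \<open>u\<close>, \<open>v\<close> and their projections, must be symmetric as well.
\<close>

lemma range_proj_range_proj_shift:
  assumes u: "isometric u" and v: "isometric v" and f: "f \<in> l2"
  shows "range_proj v (range_proj u f) = fps_X * range_proj v (range_proj u (fps_shift 1 f))
    + fps_const (ip f u) * (range_proj v u - fps_const (ip u v) * v)
    + fps_const (ip (range_proj u f) v) * v"
proof -
  have u_l2: "u \<in> l2" using u by (rule isometric_in_l2)
  have "fps_shift 1 (range_proj u f) =
      range_proj u (fps_shift 1 f) + fps_const (ip f u) * fps_shift 1 u"
    by (rule fps_ext) (simp add: range_proj_shift[OF u f])
  then have *: "range_proj v (fps_shift 1 (range_proj u f)) =
      range_proj v (range_proj u (fps_shift 1 f)) + fps_const (ip f u) * range_proj v (fps_shift 1 u)"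
    by (simp add: range_proj_add range_proj_scale range_proj_l2 l2_scale l2_shift u v f u_l2
        del: One_nat_def)
  have "fps_X * range_proj v (fps_shift 1 u) = range_proj v u - fps_const (ip u v) * v"
    using range_proj_shift[OF v u_l2] by simp
  then show ?thesis
    using range_proj_shift[OF v range_proj_l2[OF u f]] *
    by (simp add: distrib_left mult.left_commute[of fps_X])
qed

text \<open>
The symmetry of \<open>range_proj_range_proj_shift\<close> is used for the component \<open>f\<close> of \<open>v\<close> orthogonal to \<open>u\<close>.
This eliminates \<open>range_proj v u\<close> and leaves \<open>range_proj u v\<close> as a combination of \<open>u\<close> and \<open>v\<close>.
If \<open>v\<close> occurs in it, then \<open>v\<close> lies in the range of \<open>u\<close>.
\<close>

lemma commuting_range_proj_cases:
  assumes u: "isometric u" and v: "isometric v"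
    and comm: "\<And>f. f \<in> l2 \<Longrightarrow> range_proj u (range_proj v f) = range_proj v (range_proj u f)"
  shows "(\<exists>w\<in>l2. v = u * w) \<or> range_proj u v = fps_const (ip v u) * u"
proof -
  have ul: "u \<in> l2" and vl: "v \<in> l2" using u v by (auto intro: isometric_in_l2)
  define c where "c = ip v u"
  (* Orthogonal to u, but to v only if it vanishes. *)
  define f where "f = v - fps_const c * u"
  have fl: "f \<in> l2" by (simp add: f_def ul vl l2_diff l2_scale)
  show ?thesis
  proof (cases "f = 0")
    case True
    then have "v = u * fps_const c" by (simp add: f_def mult.commute)
    then show ?thesis by (intro disjI1 bexI[of _ "fps_const c"]) auto
  next
    case False
    have "ip u u = 1" using isometric_ip[OF u l2_1 l2_1] ip_1_right[of 1] by simp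
    then have fu: "ip f u = 0"
      by (simp add: f_def ip_diff_left ip_scale_left l2_scale ul vl c_def)
    have "ip f v = ip f (f + fps_const c * u)" by (simp add: f_def)
    also have "\<dots> = ip f f + cnj c * ip f u"
      by (simp add: ip_add_right ip_scale_right l2_scale fl ul)
    finally have "ip f v = ip f f + cnj c * ip f u" .
    then have fv: "ip f v \<noteq> 0" using fu ip_self_eq_0D[OF fl] False by auto
    define \<alpha> where "\<alpha> = c - ip (range_proj v f) u / ip f v"
    define \<beta> where "\<beta> = ip (range_proj u f) v / ip f v"
    have "fps_const (ip (range_proj u f) v) * v =
      fps_const (ip f v) * (range_proj u v - fps_const c * u) + fps_const (ip (range_proj v f) u) * u"
      using range_proj_range_proj_shift[OF u v fl] range_proj_range_proj_shift[OF v u fl]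
        comm[OF fl] comm[OF l2_shift[OF fl]] fu by (simp add: c_def)
    then have "fps_const (1 / ip f v) * (fps_const (ip (range_proj u f) v) * v) =
      fps_const (1 / ip f v) * (fps_const (ip f v) * (range_proj u v - fps_const c * u)
        + fps_const (ip (range_proj v f) u) * u)"
      by simp
    then have eq: "range_proj u v = fps_const \<beta> * v + fps_const \<alpha> * u"
      using fv by (simp add: \<alpha>_def \<beta>_def algebra_simps flip: mult.assoc fps_const_sub)
    show ?thesis
    proof (cases "\<beta> = 0")
      case True
      have "adj u v = adj u (range_proj u v)"
        by (simp add: range_proj_def adj_mult adj_l2 u vl)
      also have "\<dots> = fps_const \<alpha> * adj u (u * 1)"
        using eq True adj_scale[OF u ul, of \<alpha>] by simp
      also have "\<dots> = fps_const \<alpha>"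
        using adj_mult[OF u l2_1] by simp
      finally have "adj u v = fps_const \<alpha>" .
      moreover have "fps_nth (adj u v) 0 = c" by (simp add: adj_def c_def)
      ultimately show ?thesis using eq True by (auto simp: c_def)
    next
      case False
      have "v = fps_const (1 / \<beta>) * (fps_const \<beta> * v)"
        using False by (simp flip: mult.assoc)
      also have "\<dots> = fps_const (1 / \<beta>) * (range_proj u v - fps_const \<alpha> * u)"
        using eq by simp
      also have "\<dots> = u * (fps_const (1 / \<beta>) * (adj u v - fps_const \<alpha>))"
        by (simp add: range_proj_def algebra_simps)
      finally have "v = u * (fps_const (1 / \<beta>) * (adj u v - fps_const \<alpha>))" .
      then show ?thesis
        by (intro disjI1 bexI[of _ "fps_const (1 / \<beta>) * (adj u v - fps_const \<alpha>)"])
           (auto intro!: l2_scale l2_diff adj_l2 u vl)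
    qed
  qed
qed

lemma isometric_nonzero: "isometric u \<Longrightarrow> u \<noteq> 0"
  using adj_mult[of u 1] by auto

lemma isometric_X_power: "isometric (fps_X ^ n)"
proof -
  have "nrm (fps_X ^ n * f) = nrm f" if "f \<in> l2" for f
    using that by (induction n) (auto simp: mult.assoc nrm_X l2_X_power)
  then show ?thesis by (simp add: isometric_def l2_X_power)
qed

text \<open>
If both vanish, then \<open>v\<close> is orthogonal to \<open>u * fps_X ^ n\<close> and \<open>u\<close> to \<open>v * fps_X ^ n\<close> for all \<open>n\<close>.
As the shift is isometric, the ranges of \<open>u\<close> and \<open>v\<close> are then orthogonal, which is impossible
since \<open>u * v\<close> belongs to both.
\<close>

lemma adj_not_both_zero:
  assumes u: "isometric u" and v: "isometric v"
  shows "adj u v \<noteq> 0 \<or> adj v u \<noteq> 0"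
proof (rule ccontr)
  assume "\<not> ?thesis"
  then have uv: "adj u v = 0" and vu: "adj v u = 0" by auto
  have ul: "u \<in> l2" and vl: "v \<in> l2" using u v by (auto intro: isometric_in_l2)
  have l2X: "w * fps_X ^ n \<in> l2" if "isometric w" for w n
    using isometric_l2[OF that l2_X_power[OF l2_1]] by simp
  have v_un: "ip v (u * fps_X ^ n) = 0" for n
    using arg_cong[OF uv, of "\<lambda>h. fps_nth h n"] by (simp add: adj_def)
  have u_vn: "ip u (v * fps_X ^ n) = 0" for n
    using arg_cong[OF vu, of "\<lambda>h. fps_nth h n"] by (simp add: adj_def)
  have "ip (v * fps_X ^ n) (u * fps_X ^ m) = 0" for n m
  proof (cases "n \<le> m")
    case True
    then have "ip (v * fps_X ^ n) (u * fps_X ^ m) = ip (fps_X ^ n * v) (fps_X ^ n * (u * fps_X ^ (m - n)))"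
      by (simp add: mult_ac flip: power_add)
    also have "\<dots> = 0"
      by (simp add: isometric_ip isometric_X_power l2X u vl v_un)
    finally show ?thesis .
  next
    case False
    then have "ip (v * fps_X ^ n) (u * fps_X ^ m) = ip (fps_X ^ m * (v * fps_X ^ (n - m))) (fps_X ^ m * u)"
      by (simp add: mult_ac flip: power_add)
    also have "\<dots> = cnj (ip u (v * fps_X ^ (n - m)))"
      by (simp add: isometric_ip isometric_X_power l2X v ul ip_cnj)
    finally show ?thesis by (simp add: u_vn)
  qed
  then have "adj u (v * fps_X ^ n) = 0" for n
    by (intro fps_ext) (simp add: adj_def)
  then have "ip (v * fps_X ^ n) (u * v) = 0" for n
    by (simp add: ip_mult_right u l2X v vl)
  then have "ip (u * v) (v * fps_X ^ n) = 0" for n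
    using ip_cnj[OF l2X[OF v] isometric_l2[OF u vl], of n] by simp
  then have "adj v (v * u) = 0"
    by (intro fps_ext) (simp add: adj_def mult.commute)
  then show False
    using adj_mult[OF v ul] isometric_nonzero[OF u] by simp
qed

text \<open>
If neither divides the other, \<open>commuting_range_proj_cases\<close> makes \<open>range_proj u v\<close> a multiple of \<open>u\<close>
and \<open>range_proj v u\<close> a multiple of \<open>v\<close>. Commutation, evaluated at \<open>u\<close>, shows that \<open>u\<close> and \<open>v\<close> are
proportional unless both multiples are 0, and \<open>adj_not_both_zero\<close> excludes that.
\<close>

lemma divides_if_range_projs_commute:
  assumes u: "isometric u" and v: "isometric v"
    and comm: "\<And>f. f \<in> l2 \<Longrightarrow> range_proj u (range_proj v f) = range_proj v (range_proj u f)"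
  shows "(\<exists>w\<in>l2. v = u * w) \<or> (\<exists>w\<in>l2. u = v * w)"
proof (rule ccontr)
  assume no: "\<not> ?thesis"
  have ul: "u \<in> l2" and vl: "v \<in> l2" using u v by (auto intro: isometric_in_l2)
  define c where "c = ip v u"
  have uv: "range_proj u v = fps_const c * u"
    using commuting_range_proj_cases[OF u v comm] no by (auto simp: c_def)
  have vu: "range_proj v u = fps_const (cnj c) * v"
    using commuting_range_proj_cases[OF v u comm[symmetric]] no by (auto simp: c_def ip_cnj ul vl)
  have "fps_const (cnj c) * (fps_const c * u) = range_proj u (range_proj v u)"
    by (simp add: vu range_proj_scale u vl uv)
  also have "\<dots> = fps_const (cnj c) * v"
    using comm[OF ul] by (simp only: range_proj_self[OF u] vu)
  finally have eq: "fps_const (cnj c) * (v - fps_const c * u) = 0"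
    by (simp only: right_diff_distrib diff_self)
  have "c = 0"
  proof (rule ccontr)
    assume "c \<noteq> 0"
    with eq have "v - fps_const c * u = 0" by (metis complex_cnj_zero_iff fps_const_eq_0_iff mult_eq_0_iff)
    then have "v = u * fps_const c" by (simp add: mult.commute)
    with no show False by (metis l2_const)
  qed
  then show False
    using uv vu adj_not_both_zero[OF u v] isometric_nonzero[OF u] isometric_nonzero[OF v]
    by (auto simp: range_proj_def)
qed

section \<open>Compressions of multipliers to model spaces\<close>

definition model :: "complex fps \<Rightarrow> complex fps set" where
  "model u = {f \<in> l2. \<forall>g\<in>l2. ip f (u * g) = 0}"

lemma model_l2: "f \<in> model u \<Longrightarrow> f \<in> l2"
  by (simp add: model_def)

lemma model_iff: "isometric u \<Longrightarrow> f \<in> model u \<longleftrightarrow> f \<in> l2 \<and> adj u f = 0"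
  using adj_l2[of u f] ip_self_eq_0D[of "adj u f"] by (auto simp: model_def ip_mult_right)

definition model_proj :: "complex fps \<Rightarrow> complex fps \<Rightarrow> complex fps" where
  "model_proj u f = f - range_proj u f"

lemma model_proj_in_model: "isometric u \<Longrightarrow> f \<in> l2 \<Longrightarrow> model_proj u f \<in> model u"
  by (auto simp: model_iff model_proj_def range_proj_def adj_diff adj_mult adj_l2 isometric_l2 l2_diff)

lemma model_proj_orthogonal:
  "isometric u \<Longrightarrow> f \<in> l2 \<Longrightarrow> h \<in> model u \<Longrightarrow> ip (f - model_proj u f) h = 0"
  by (auto simp: model_iff model_proj_def range_proj_def ip_mult_left adj_l2)

lemma model_proj_Pythagoras:
  assumes u: "isometric u" and f: "f \<in> l2"
  shows "(nrm f)\<^sup>2 = (nrm (model_proj u f))\<^sup>2 + (nrm (range_proj u f))\<^sup>2"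
proof -
  have "ip (range_proj u f) (model_proj u f) = 0"
    using model_proj_orthogonal[OF u f model_proj_in_model[OF u f]] by (simp add: model_proj_def)
  then show ?thesis
    using nrm_add_sqr[of "range_proj u f" "model_proj u f"]
      range_proj_l2[OF u f] model_l2[OF model_proj_in_model[OF u f]]
    by (simp add: model_proj_def)
qed

lemma nrm_model_proj_le: "isometric u \<Longrightarrow> f \<in> l2 \<Longrightarrow> nrm (model_proj u f) \<le> nrm f"
  by (rule power2_le_imp_le) (auto simp: model_proj_Pythagoras[of u f] nrm_nonneg)

definition compression :: "complex fps \<Rightarrow> complex fps \<Rightarrow> complex fps \<Rightarrow> complex fps" where
  "compression u v f = model_proj u (v * f)"

lemma compression_in_model:
  "isometric u \<Longrightarrow> isometric v \<Longrightarrow> f \<in> l2 \<Longrightarrow> compression u v f \<in> model u"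
  by (simp add: compression_def model_proj_in_model isometric_l2)

lemma compression_add: "isometric u \<Longrightarrow> isometric v \<Longrightarrow> f \<in> l2 \<Longrightarrow> g \<in> l2 \<Longrightarrow>
    compression u v (f + g) = compression u v f + compression u v g"
  by (simp add: compression_def model_proj_def distrib_left range_proj_add isometric_l2)

lemma compression_scale: "isometric u \<Longrightarrow> isometric v \<Longrightarrow> f \<in> l2 \<Longrightarrow>
    compression u v (fps_const c * f) = fps_const c * compression u v f"
  by (simp add: compression_def model_proj_def mult.left_commute[of v] range_proj_scale isometric_l2
      right_diff_distrib)

lemma nrm_compression_le: "isometric u \<Longrightarrow> isometric v \<Longrightarrow> f \<in> l2 \<Longrightarrow> nrm (compression u v f) \<le> nrm f"
  using nrm_model_proj_le[of u "v * f"] by (simp add: compression_def isometric_l2 isometric_nrm)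

text \<open>
The norm condition in the definition of a partial isometry, for the compression of \<open>v\<close> to the
model space of \<open>u\<close>.
\<close>

definition isometric_off_kernel :: "complex fps \<Rightarrow> complex fps \<Rightarrow> bool" where
  "isometric_off_kernel u v \<longleftrightarrow> (\<forall>f\<in>model u.
     (\<forall>k\<in>model u. compression u v k = 0 \<longrightarrow> ip f k = 0) \<longrightarrow> nrm (compression u v f) = nrm f)"

text \<open>
For \<open>g\<close> in the model space of \<open>u\<close>, \<open>adj v g\<close> is the adjoint of the compression applied to \<open>g\<close>, so
it is orthogonal to the kernel. Multiplication by \<open>v\<close> and its compression thus preserve the norm
of \<open>adj v g\<close>, and by Pythagoras \<open>range_proj v g\<close> has no component in the range of \<open>u\<close>.
\<close>

lemma range_projs_commute:
  assumes u: "isometric u" and v: "isometric v" and iso: "isometric_off_kernel u v" and f: "f \<in> l2"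
  shows "range_proj u (range_proj v f) = range_proj v (range_proj u f)"
proof -
  have zero: "range_proj u (range_proj v g) = 0" if g: "g \<in> model u" for g
  proof -
    have gl: "g \<in> l2" using g by (rule model_l2)
    (* The adjoint of the compression, applied to g. *)
    define h where "h = adj v g"
    have hl: "h \<in> l2" by (simp add: h_def adj_l2 v gl)
    have "ip h (u * x) = 0" if "x \<in> l2" for x
    proof -
      have "ip h (u * x) = ip g (u * (v * x))"
        by (simp add: h_def v gl isometric_l2 u that mult.left_commute flip: ip_mult_right)
      also have "\<dots> = 0" using g that by (simp add: model_def isometric_l2 v)
      finally show ?thesis .
    qed
    then have hm: "h \<in> model u" using hl by (simp add: model_def)
    have "ip h k = 0" if k: "k \<in> model u" and Tk: "compression u v k = 0" for k
    proof -
      have kl: "k \<in> l2" using k by (rule model_l2)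
      have "v * k = u * adj u (v * k)"
        using Tk by (simp add: compression_def model_proj_def range_proj_def)
      then have "ip g (v * k) = ip g (u * adj u (v * k))" by simp
      also have "\<dots> = 0" using g by (simp add: model_def adj_l2 u isometric_l2 v kl)
      finally show ?thesis by (simp add: h_def v gl kl flip: ip_mult_right)
    qed
    then have "nrm (compression u v h) = nrm (v * h)"
      using iso hm by (auto simp: isometric_off_kernel_def isometric_nrm v hl)
    then have "nrm (range_proj u (v * h)) = 0"
      using model_proj_Pythagoras[OF u isometric_l2[OF v hl]] by (simp add: compression_def)
    then show ?thesis
      unfolding range_proj_def[of v] h_def[symmetric]
      by (intro nrm_eq_0D) (auto simp: range_proj_l2 u isometric_l2 v hl)
  qed
  (* The right-hand side is a self-adjoint operator, so the left-hand side is self-adjoint too. *)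
  have E: "range_proj u (range_proj v g) = range_proj u (range_proj v (range_proj u g))"
    if "g \<in> l2" for g
    using zero[OF model_proj_in_model[OF u that]]
    by (simp add: model_proj_def range_proj_diff range_proj_l2 u v that)
  have "ip (range_proj v (range_proj u f)) g = ip (range_proj u (range_proj v f)) g" if g: "g \<in> l2" for g
  proof -
    have "ip (range_proj v (range_proj u f)) g = ip f (range_proj u (range_proj v (range_proj u g)))"
      by (simp add: range_proj_sym range_proj_l2 u v f g flip: E)
    also have "\<dots> = ip (range_proj u (range_proj v (range_proj u f))) g"
      by (simp add: range_proj_sym range_proj_l2 u v f g)
    finally show ?thesis by (simp add: E[OF f])
  qed
  then show ?thesis
    by (intro l2_eqI) (auto simp: range_proj_l2 u v f)
qed

lemma compression_eq_0:
  assumes u: "isometric u" and w: "isometric w" and f: "f \<in> l2"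
  shows "compression u (u * w) f = 0"
  using range_proj_mult[OF u isometric_l2[OF w f]]
  by (simp add: compression_def model_proj_def mult.assoc)

text \<open>
The model space of \<open>v * w\<close> contains \<open>w * h\<close> for every \<open>h\<close> in the model space of \<open>v\<close>, and the
compression of \<open>v\<close> sends these elements to 0. An \<open>f\<close> in the model space of \<open>v * w\<close>
that is orthogonal to them is orthogonal to the whole range of \<open>w\<close>, and then \<open>v * f\<close> is orthogonal to the range of \<open>v * w\<close>.
\<close>

lemma isometric_off_kernel_mult:
  assumes v: "isometric v" and w: "isometric w" and u: "isometric (v * w)"
  shows "isometric_off_kernel (v * w) v"
  unfolding isometric_off_kernel_def
proof (intro ballI impI)
  fix f assume f: "f \<in> model (v * w)"
    and orth: "\<forall>k\<in>model (v * w). compression (v * w) v k = 0 \<longrightarrow> ip f k = 0"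
  have fl: "f \<in> l2" using f by (rule model_l2)
  have fw: "ip f (w * h) = 0" if h: "h \<in> l2" for h
  proof -
    define h1 where "h1 = model_proj v h"
    have h1: "h1 \<in> model v" and h1l: "h1 \<in> l2"
      using model_proj_in_model[OF v h] by (auto simp: h1_def model_l2)
    have "ip (w * h1) (v * w * x) = 0" if x: "x \<in> l2" for x
    proof -
      have "ip (w * h1) (v * w * x) = ip h1 (v * x)"
        using isometric_ip[OF w h1l isometric_l2[OF v x]] by (simp add: mult_ac)
      then show ?thesis using h1 x by (simp add: model_def)
    qed
    then have "w * h1 \<in> model (v * w)"
      by (simp add: model_def isometric_l2 w h1l)
    moreover have "compression (v * w) v (w * h1) = 0"
      using range_proj_mult[OF u h1l] by (simp add: compression_def model_proj_def mult.assoc)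
    ultimately have "ip f (w * h1) = 0" using orth by blast
    moreover have "ip f (w * range_proj v h) = 0"
      using f adj_l2[OF v h] by (auto simp: range_proj_def model_def mult_ac)
    moreover have "w * h = w * h1 + w * range_proj v h"
      by (simp add: h1_def model_proj_def flip: distrib_left)
    ultimately show ?thesis
      by (simp add: ip_add_right isometric_l2 w h1l range_proj_l2 v h fl)
  qed
  have "ip (v * f) (v * w * x) = 0" if x: "x \<in> l2" for x
    using isometric_ip[OF v fl isometric_l2[OF w x]] fw[OF x] by (simp add: mult.assoc)
  then have "v * f \<in> model (v * w)"
    by (simp add: model_def isometric_l2 v fl)
  then have "compression (v * w) v f = v * f"
    by (simp add: compression_def model_proj_def range_proj_def model_iff[OF u])
  then show "nrm (compression (v * w) v f) = nrm f"
    by (simp add: isometric_nrm v fl)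
qed

theorem isometric_off_kernel_iff:
  assumes u: "isometric u" and v: "isometric v"
  shows "isometric_off_kernel u v \<longleftrightarrow> (\<exists>w\<in>l2. u = v * w) \<or> (\<exists>w\<in>l2. v = u * w)"
proof
  assume "isometric_off_kernel u v"
  then show "(\<exists>w\<in>l2. u = v * w) \<or> (\<exists>w\<in>l2. v = u * w)"
    using divides_if_range_projs_commute[OF u v range_projs_commute[OF u v]] by blast
next
  assume "(\<exists>w\<in>l2. u = v * w) \<or> (\<exists>w\<in>l2. v = u * w)"
  then show "isometric_off_kernel u v"
  proof (elim disjE bexE)
    fix w assume w: "w \<in> l2" "u = v * w"
    then show ?thesis
      using isometric_off_kernel_mult[OF v isometric_quotient[OF v u w(2,1)]] u by simp
  next
    fix w assume w: "w \<in> l2" "v = u * w"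
    have zero: "compression u v f = 0" if "f \<in> model u" for f
      using compression_eq_0[OF u isometric_quotient[OF u v w(2,1)] model_l2[OF that]] w by simp
    show ?thesis
      unfolding isometric_off_kernel_def
      by (metis zero ip_self_eq_0D model_l2)
  qed
qed

section \<open>Inner functions are isometric multipliers\<close>

lemma fps_conv_radius_l2: assumes "f \<in> l2" shows "fps_conv_radius f \<ge> 1"
  unfolding fps_conv_radius_def
proof (rule conv_radius_geI_ex)
  fix r :: real assume r: "0 < r" "ereal r < 1"
  have S: "summable (\<lambda>n. nrm f * r ^ n)"
    using r by (intro summable_mult summable_geometric) auto
  have "summable (\<lambda>n. fps_nth f n * of_real r ^ n)"
    by (rule summable_comparison_test'[OF S, where N = 0])
       (use r nth_le_nrm[OF assms] in \<open>auto simp: norm_mult norm_power intro!: mult_right_mono\<close>)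
  with r show "\<exists>z. norm z = r \<and> summable (\<lambda>n. fps_nth f n * z ^ n)"
    by (intro exI[of _ "of_real r"]) auto
qed

text \<open>
All powers of \<open>u\<close> have norm 1, so their coefficients are bounded by 1 and the powers of the
number \<open>eval_fps u z\<close> stay below the sum of a geometric series.
\<close>

lemma isometric_eval_le_1:
  assumes u: "isometric u" and z: "cmod z < 1"
  shows "cmod (eval_fps u z) \<le> 1"
proof (rule ccontr)
  assume "\<not> ?thesis"
  then obtain n where n: "1 / (1 - cmod z) < cmod (eval_fps u z) ^ n"
    using real_arch_pow[of "cmod (eval_fps u z)" "1 / (1 - cmod z)"] by auto
  have pow: "u ^ n \<in> l2 \<and> nrm (u ^ n) = 1"
  proof (induction n)
    case 0
    have "nrm 1 ^ 2 = 1"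
      using ip_self[OF l2_1] by (simp add: ip_1_right flip: of_real_power)
    then show ?case using nrm_nonneg[OF l2_1] by (simp add: power2_eq_1_iff)
  qed (use u in \<open>auto simp: isometric_l2 isometric_nrm\<close>)
  have zr: "ereal (cmod z) < fps_conv_radius u"
    using fps_conv_radius_l2[OF isometric_in_l2[OF u]] z
    by (metis ereal_less(3) less_le_trans)
  have S: "summable (\<lambda>k. cmod z ^ k)" using z by (intro summable_geometric) auto
  have "cmod (eval_fps u z) ^ n = cmod (\<Sum>k. fps_nth (u ^ n) k * z ^ k)"
    using eval_fps_power[OF zr, of n] by (simp add: eval_fps_def norm_power)
  also have "\<dots> \<le> (\<Sum>k. cmod z ^ k)"
    using nth_le_nrm[of "u ^ n"] pow
    by (intro norm_suminf_le S) (auto simp: norm_mult norm_power mult_left_le_one_le)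
  also have "\<dots> = 1 / (1 - cmod z)" using z by (intro suminf_geometric) auto
  finally show False using n by simp
qed

abbreviation circle :: "real measure" where
  "circle \<equiv> restrict_space lborel {0..2*pi}"

lemma finite_measure_circle: "finite_measure circle"
  by (rule finite_measureI) (simp add: emeasure_restrict_space)

lemma integrable_circle:
  fixes g :: "real \<Rightarrow> 'a :: euclidean_space"
  assumes "continuous_on UNIV g" shows "integrable circle g"
  using borel_integrable_atLeastAtMost'[of 0 "2 * pi" g] continuous_on_subset[OF assms]
  by (simp add: integrable_restrict_space set_integrable_def)

lemma integral_cis:
  "integral\<^sup>L circle (\<lambda>t. cis (of_int k * t)) = (if k = 0 then of_real (2 * pi) else 0)"
proof (cases "k = 0")
  case True
  then show ?thesis by (simp add: measure_restrict_space scaleR_conv_of_real)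
next
  case False
  let ?F = "\<lambda>t. cis (of_int k * t) / (\<i> * of_int k)"
  have "integral\<^sup>L circle (\<lambda>t. cis (of_int k * t)) = ?F (2 * pi) - ?F 0"
    unfolding integral_restrict_space[where M = lborel and \<Omega> = "{0..2*pi}", simplified]
  proof (rule integral_FTC_atLeastAtMost)
    fix t :: real
    show "(?F has_vector_derivative cis (of_int k * t)) (at t within {0..2 * pi})"
      unfolding cis_conv_exp using False
      by (auto intro!: derivative_eq_intros has_vector_derivative_real_field simp: field_simps)
  qed (auto intro!: continuous_intros)
  also have "?F (2 * pi) = ?F 0"
    using cis_multiple_2pi[of "of_int k"] by (simp add: mult_ac)
  finally show ?thesis using False by simp
qed

lemma Parseval_trig_polynomial:
  "integral\<^sup>L circle (\<lambda>t. (cmod (\<Sum>n<N. c n * cis (real n * t)))\<^sup>2) = 2 * pi * (\<Sum>n<N. (cmod (c n))\<^sup>2)"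
proof -
  have expand: "of_real ((cmod (\<Sum>n<N. c n * cis (real n * t)))\<^sup>2) =
      (\<Sum>n<N. \<Sum>m<N. c n * cnj (c m) * cis (of_int (int n - int m) * t))" for t
    unfolding complex_norm_square cnj_sum sum_product
    by (intro sum.cong refl) (simp add: cis_cnj cis_mult algebra_simps)
  have int: "integrable circle (\<lambda>t. cis (of_int k * t))" for k
    by (intro integrable_circle continuous_intros)
  have "of_real (integral\<^sup>L circle (\<lambda>t. (cmod (\<Sum>n<N. c n * cis (real n * t)))\<^sup>2)) =
      integral\<^sup>L circle (\<lambda>t. of_real ((cmod (\<Sum>n<N. c n * cis (real n * t)))\<^sup>2) :: complex)"
    by (rule integral_complex_of_real[symmetric])
  also have "\<dots> = (\<Sum>n<N. \<Sum>m<N. c n * cnj (c m) * (if n = m then of_real (2 * pi) else 0))"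
    unfolding expand
    by (subst Bochner_Integration.integral_sum;
        auto intro!: int sum.cong simp: integral_cis simp del: of_int_diff)+
  also have "\<dots> = of_real (2 * pi * (\<Sum>n<N. (cmod (c n))\<^sup>2))"
    by (simp add: if_distrib sum_distrib_left complex_norm_square mult_ac cong: if_cong
        del: of_real_power)
  finally show ?thesis by (simp only: of_real_eq_iff)
qed

lemma summable_norm_sqr:
  assumes c: "summable (\<lambda>n. cmod (c n))" shows "summable (\<lambda>n. (cmod (c n))\<^sup>2)"
proof -
  obtain N where N: "\<And>n. n \<ge> N \<Longrightarrow> cmod (c n) < 1"
    using order_tendstoD(2)[OF summable_LIMSEQ_zero[OF c], of 1]
    by (auto simp: eventually_sequentially)
  show ?thesis
    by (rule summable_comparison_test'[OF c, where N = N])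
       (use N in \<open>force simp: power2_eq_square intro: mult_left_le less_imp_le\<close>)
qed

text \<open>
The identity for trigonometric polynomials passes to the limit by dominated convergence, with the
sum of the moduli of the coefficients as a bound.
\<close>

lemma Parseval_circle:
  assumes c: "summable (\<lambda>n. cmod (c n))"
  shows "integral\<^sup>L circle (\<lambda>t. (cmod (\<Sum>n. c n * cis (real n * t)))\<^sup>2) = 2 * pi * (\<Sum>n. (cmod (c n))\<^sup>2)"
proof (rule LIMSEQ_unique)
  interpret finite_measure circle by (rule finite_measure_circle)
  let ?s = "\<lambda>N t. \<Sum>n<N. c n * cis (real n * t)"
  have S: "summable (\<lambda>n. c n * cis (real n * t))" for t
    by (rule summable_norm_cancel) (simp add: norm_mult c)
  have lim: "(\<lambda>N. ?s N t) \<longlonglongrightarrow> (\<Sum>n. c n * cis (real n * t))" for t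
    by (intro summable_LIMSEQ S)
  have meas: "?s N \<in> borel_measurable circle" for N
    by (intro borel_measurable_integrable integrable_circle continuous_intros)
  show "(\<lambda>N. integral\<^sup>L circle (\<lambda>t. (cmod (?s N t))\<^sup>2)) \<longlonglongrightarrow>
      integral\<^sup>L circle (\<lambda>t. (cmod (\<Sum>n. c n * cis (real n * t)))\<^sup>2)"
  proof (rule integral_dominated_convergence[where w = "\<lambda>_. (\<Sum>n. cmod (c n))\<^sup>2"])
    show "(\<lambda>t. (cmod (\<Sum>n. c n * cis (real n * t)))\<^sup>2) \<in> borel_measurable circle"
      using borel_measurable_LIMSEQ_metric[OF meas lim] by measurable
    show "AE t in circle. norm ((cmod (?s N t))\<^sup>2) \<le> (\<Sum>n. cmod (c n))\<^sup>2" for N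
    proof (intro always_eventually allI)
      fix t
      have "cmod (?s N t) \<le> (\<Sum>n<N. cmod (c n))"
        by (rule order_trans[OF norm_sum]) (simp add: norm_mult)
      also have "\<dots> \<le> (\<Sum>n. cmod (c n))" by (intro sum_le_suminf c) auto
      finally show "norm ((cmod (?s N t))\<^sup>2) \<le> (\<Sum>n. cmod (c n))\<^sup>2"
        by (simp add: power_mono)
    qed
    show "AE t in circle. (\<lambda>N. (cmod (?s N t))\<^sup>2) \<longlonglongrightarrow> (cmod (\<Sum>n. c n * cis (real n * t)))\<^sup>2"
      by (intro always_eventually allI tendsto_intros lim)
    show "(\<lambda>t. (cmod (?s N t))\<^sup>2) \<in> borel_measurable circle" for N
      using meas by measurable
  qed simp
  show "(\<lambda>N. integral\<^sup>L circle (\<lambda>t. (cmod (?s N t))\<^sup>2)) \<longlonglongrightarrow> 2 * pi * (\<Sum>n. (cmod (c n))\<^sup>2)"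
    unfolding Parseval_trig_polynomial by (intro tendsto_intros summable_LIMSEQ summable_norm_sqr c)
qed

lemma Parseval_eval_fps:
  assumes "fps_conv_radius F \<ge> 1" "0 \<le> r" "r < 1"
  shows "integral\<^sup>L circle (\<lambda>t. (cmod (eval_fps F (of_real r * cis t)))\<^sup>2) =
    2 * pi * (\<Sum>n. (cmod (fps_nth F n))\<^sup>2 * (r\<^sup>2) ^ n)"
proof -
  have "ereal (norm (of_real r :: complex)) < fps_conv_radius F"
    using assms by (metis abs_of_nonneg ereal_less(3) less_le_trans norm_of_real)
  from norm_summable_fps[OF this] Parseval_circle[of "\<lambda>n. fps_nth F n * of_real r ^ n"]
  show ?thesis
    by (simp add: eval_fps_def power_mult_distrib norm_mult norm_power Complex.DeMoivre
        power_even_eq mult_ac assms(2) flip: power_mult)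
qed

lemma fps_expansion_unit_disc:
  assumes "f holomorphic_on unit_disc"
  shows "fps_conv_radius (fps_expansion f 0) \<ge> 1"
    and "cmod z < 1 \<Longrightarrow> eval_fps (fps_expansion f 0) z = f z"
  using conv_radius_fps_expansion[of f 0 1] eval_fps_expansion'[of f 0 1 z] assms
  by (auto simp: one_ereal_def simp flip: eball_ereal)

lemma less_fps_conv_radius: "fps_conv_radius F \<ge> 1 \<Longrightarrow> cmod z < 1 \<Longrightarrow> ereal (cmod z) < fps_conv_radius F"
  by (metis ereal_less(3) less_le_trans)

lemma fps_expansion_eqI:
  assumes F: "fps_conv_radius F \<ge> 1" and f: "\<And>z. cmod z < 1 \<Longrightarrow> f z = eval_fps F z"
  shows "fps_expansion f 0 = F"
proof -
  have "eventually (\<lambda>z. z \<in> unit_disc) (nhds 0)"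
    by (intro eventually_nhds_in_open) auto
  then have "eventually (\<lambda>z. eval_fps F z = f z) (nhds 0)"
    by eventually_elim (simp add: f)
  moreover have "fps_conv_radius F > 0"
    by (rule less_le_trans[OF _ F]) simp
  ultimately have "f has_fps_expansion F"
    by (simp add: has_fps_expansion_def)
  from fps_nth_fps_expansion[OF this] show ?thesis
    by (intro fps_ext) (simp add: fps_expansion_def)
qed

lemma fps_expansion_mult:
  assumes "f holomorphic_on unit_disc" "g holomorphic_on unit_disc"
  shows "fps_expansion (\<lambda>z. f z * g z) 0 = fps_expansion f 0 * fps_expansion g 0"
proof (rule fps_expansion_eqI)
  note r = fps_expansion_unit_disc(1)[OF assms(1)] fps_expansion_unit_disc(1)[OF assms(2)]
  show "1 \<le> fps_conv_radius (fps_expansion f 0 * fps_expansion g 0)"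
    by (rule order_trans[OF _ fps_conv_radius_mult]) (use r in auto)
  fix z :: complex assume "cmod z < 1"
  then show "f z * g z = eval_fps (fps_expansion f 0 * fps_expansion g 0) z"
    using assms r by (simp add: eval_fps_mult fps_expansion_unit_disc less_fps_conv_radius)
qed

text \<open>
Parseval's identity on the circle of radius \<open>r\<close> bounds the weighted partial sums by \<open>C\<^sup>2\<close>; let \<open>r\<close>
tend to 1.
\<close>

lemma bounded_imp_l2:
  assumes hol: "f holomorphic_on unit_disc" and C: "\<And>z. cmod z < 1 \<Longrightarrow> cmod (f z) \<le> C"
  shows "fps_expansion f 0 \<in> l2"
proof -
  interpret finite_measure circle by (rule finite_measure_circle)
  let ?F = "fps_expansion f 0"
  have mean: "(\<Sum>n<N. (cmod (fps_nth ?F n))\<^sup>2 * (r\<^sup>2) ^ n) \<le> C\<^sup>2" if r: "0 < r" "r < 1" for r N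
  proof -
    have cr: "cmod (of_real r * cis t) < 1" for t using r by (simp add: norm_mult)
    have cont: "continuous_on UNIV (\<lambda>t. (cmod (eval_fps ?F (of_real r * cis t)))\<^sup>2)"
      using less_fps_conv_radius[OF fps_expansion_unit_disc(1)[OF hol] cr]
      by (intro continuous_intros) auto
    have "2 * pi * (\<Sum>n. (cmod (fps_nth ?F n))\<^sup>2 * (r\<^sup>2) ^ n) \<le> integral\<^sup>L circle (\<lambda>_. C\<^sup>2)"
      unfolding Parseval_eval_fps[OF fps_expansion_unit_disc(1)[OF hol] less_imp_le[OF r(1)] r(2), symmetric]
      by (intro integral_mono integrable_circle cont power_mono) (auto simp: C cr fps_expansion_unit_disc(2)[OF hol])
    also have "\<dots> = 2 * pi * C\<^sup>2" by (simp add: measure_restrict_space)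
    finally have le: "(\<Sum>n. (cmod (fps_nth ?F n))\<^sup>2 * (r\<^sup>2) ^ n) \<le> C\<^sup>2" by simp
    have "summable (\<lambda>n. (cmod (fps_nth ?F n))\<^sup>2 * (r\<^sup>2) ^ n)"
    proof -
      have n: "summable (\<lambda>n. norm (fps_nth ?F n * of_real r ^ n))"
        using norm_summable_fps[OF less_fps_conv_radius[OF fps_expansion_unit_disc(1)[OF hol] cr[of 0]]]
        by simp
      have pow: "(r ^ n)\<^sup>2 = (r\<^sup>2) ^ n" for n
        by (metis mult.commute power_mult)
      have "(cmod (fps_nth ?F n * of_real r ^ n))\<^sup>2 = (cmod (fps_nth ?F n))\<^sup>2 * (r\<^sup>2) ^ n" for n
        by (simp only: norm_mult norm_power norm_of_real abs_of_pos[OF r(1)] power_mult_distrib pow)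
      with summable_norm_sqr[OF n] show ?thesis by (simp only:)
    qed
    from sum_le_suminf[OF this, of "{..<N}"] le show ?thesis by simp
  qed
  have "(\<Sum>n<N. (cmod (fps_nth ?F n))\<^sup>2) \<le> C\<^sup>2" for N
  proof (rule tendsto_upperbound)
    have "((\<lambda>r. \<Sum>n<N. (cmod (fps_nth ?F n))\<^sup>2 * (r\<^sup>2) ^ n) \<longlongrightarrow> (\<Sum>n<N. (cmod (fps_nth ?F n))\<^sup>2 * (1\<^sup>2) ^ n)) (at_left (1::real))"
      by (intro tendsto_intros)
    then show "((\<lambda>r. \<Sum>n<N. (cmod (fps_nth ?F n))\<^sup>2 * (r\<^sup>2) ^ n) \<longlongrightarrow> (\<Sum>n<N. (cmod (fps_nth ?F n))\<^sup>2)) (at_left (1::real))"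
      by simp
    show "\<forall>\<^sub>F r in at_left 1. (\<Sum>n<N. (cmod (fps_nth ?F n))\<^sup>2 * (r\<^sup>2) ^ n) \<le> C\<^sup>2"
      using eventually_at_left_real[of 0 "1::real"] by (auto elim!: eventually_mono intro: mean)
  qed simp
  then have "summable (\<lambda>n. (cmod (fps_nth ?F n))\<^sup>2)"
    by (intro summableI_nonneg_bounded) auto
  then show ?thesis by (simp add: l2_def)
qed

text \<open>
Parseval's identity turns the mean into a series in \<open>r\<close> whose terms are dominated by the terms
of the norm, so the limit can be taken termwise.
\<close>

lemma mean_tendsto_nrm:
  assumes F: "F \<in> l2"
  shows "((\<lambda>r. integral\<^sup>L circle (\<lambda>t. (cmod (eval_fps F (of_real r * cis t)))\<^sup>2))
    \<longlongrightarrow> 2 * pi * (nrm F)\<^sup>2) (at_left 1)"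
proof -
  have ev: "\<forall>\<^sub>F r in at_left (1::real). 0 < r \<and> r < 1"
    using eventually_at_left_real[of 0 "1::real"] by (auto elim!: eventually_mono)
  have "((\<lambda>r. \<Sum>n. (cmod (fps_nth F n))\<^sup>2 * (r\<^sup>2) ^ n) \<longlongrightarrow> (\<Sum>n. (cmod (fps_nth F n))\<^sup>2)) (at_left (1::real))"
  proof (rule tannerys_theorem[THEN conjunct2, THEN conjunct2])
    show "((\<lambda>r. (cmod (fps_nth F n))\<^sup>2 * (r\<^sup>2) ^ n) \<longlongrightarrow> (cmod (fps_nth F n))\<^sup>2) (at_left (1::real))" for n
      by (auto intro!: tendsto_eq_intros)
    have "\<forall>\<^sub>F (n, r) in sequentially \<times>\<^sub>F at_left (1::real). 0 < r \<and> r < 1"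
      using eventually_prodI[OF always_eventually ev, of "\<lambda>_::nat. True" sequentially] by (simp add: case_prod_unfold)
    then show "\<forall>\<^sub>F (n, r) in sequentially \<times>\<^sub>F at_left (1::real).
        norm ((cmod (fps_nth F n))\<^sup>2 * (r\<^sup>2) ^ n) \<le> (cmod (fps_nth F n))\<^sup>2"
      by eventually_elim (auto intro!: mult_left_le power_le_one)
  qed (use F in \<open>auto simp: l2_def\<close>)
  then have "((\<lambda>r. 2 * pi * (\<Sum>n. (cmod (fps_nth F n))\<^sup>2 * (r\<^sup>2) ^ n)) \<longlongrightarrow> 2 * pi * (nrm F)\<^sup>2) (at_left (1::real))"
    unfolding nrm_sqr[OF F] by (intro tendsto_intros)
  then show ?thesis
  proof (rule Lim_transform_eventually)
    show "\<forall>\<^sub>F r in at_left 1. 2 * pi * (\<Sum>n. (cmod (fps_nth F n))\<^sup>2 * (r\<^sup>2) ^ n) =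
        integral\<^sup>L circle (\<lambda>t. (cmod (eval_fps F (of_real r * cis t)))\<^sup>2)"
      using ev by eventually_elim (simp add: Parseval_eval_fps fps_conv_radius_l2 F)
  qed
qed

text \<open>
Only here do the boundary values enter. The squared norms of \<open>p\<close> and of its product with \<open>\<phi>\<close> are
limits of circle means. The difference of the integrands is bounded and tends to 0 almost
everywhere, as the modulus of \<open>\<phi>\<close> tends to 1 radially.
\<close>

lemma nrm_mult_inner:
  assumes inner: "inner_function \<phi>" and p: "p holomorphic_on unit_disc"
    and B: "\<And>z. cmod z < 1 \<Longrightarrow> cmod (p z) \<le> B"
  shows "fps_expansion \<phi> 0 * fps_expansion p 0 \<in> l2"
    "nrm (fps_expansion \<phi> 0 * fps_expansion p 0) = nrm (fps_expansion p 0)"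
proof -
  interpret finite_measure circle by (rule finite_measure_circle)
  have \<phi>: "\<phi> holomorphic_on unit_disc"
    using inner by (simp add: inner_function_def H_infinity_def)
  obtain C where "\<forall>z\<in>unit_disc. cmod (\<phi> z) \<le> C"
    using inner unfolding inner_function_def H_infinity_def bounded_iff by blast
  then have C: "cmod (\<phi> z) \<le> C" if "cmod z < 1" for z
    using that by simp
  have AE: "AE t in circle. \<exists>l. ((\<lambda>r. \<phi> (of_real r * cis t)) \<longlongrightarrow> l) (at_left 1) \<and> cmod l = 1"
    using inner by (subst AE_restrict_space_iff) (auto simp: inner_function_def)
  have C0: "0 \<le> C" using order_trans[OF norm_ge_zero C[of 0]] by simp
  let ?f = "\<lambda>z. \<phi> z * p z"
  let ?F = "fps_expansion ?f 0" and ?P = "fps_expansion p 0"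
  have f: "?f holomorphic_on unit_disc" by (intro holomorphic_intros \<phi> p)
  have fb: "cmod (?f z) \<le> C * B" if "cmod z < 1" for z
    using C B that C0 by (auto simp: norm_mult intro!: mult_mono)
  have F: "?F \<in> l2" and P: "?P \<in> l2"
    using bounded_imp_l2[OF f fb] bounded_imp_l2[OF p B] by auto
  note mult = fps_expansion_mult[OF \<phi> p]
  show "fps_expansion \<phi> 0 * ?P \<in> l2" using F by (simp add: mult)
  (* Dominated convergence is about sequences, so the radius runs through one. *)
  define r where "r k = 1 - inverse (real (Suc (Suc k)))" for k
  have r: "0 < r k" "r k < 1" for k
    by (auto simp: r_def field_simps)
  have r_lim: "filterlim r (at_left 1) sequentially"
    unfolding filterlim_at
  proof
    show "\<forall>\<^sub>F k in sequentially. r k \<in> {..<1} \<and> r k \<noteq> 1"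
      using r(2) by (auto intro!: always_eventually simp: less_imp_neq)
    have "(\<lambda>k. 1 - inverse (real (Suc (Suc k)))) \<longlonglongrightarrow> 1 - 0"
      by (intro tendsto_diff tendsto_const LIMSEQ_Suc[OF LIMSEQ_inverse_real_of_nat])
    then show "r \<longlonglongrightarrow> 1" by (simp add: r_def[abs_def])
  qed
  have cr: "cmod (of_real (r k) * cis t) < 1" for k t using r[of k] by (simp add: norm_mult)
  define s where "s k = (\<lambda>t. (cmod (?f (of_real (r k) * cis t)))\<^sup>2 - (cmod (p (of_real (r k) * cis t)))\<^sup>2)" for k
  have cont: "continuous_on UNIV (\<lambda>t. (cmod (g (of_real (r k) * cis t)))\<^sup>2)"
    if "g holomorphic_on unit_disc" for g k
  proof -
    have "continuous_on UNIV (\<lambda>t. of_real (r k) * cis t)" by (intro continuous_intros)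
    then have "continuous_on UNIV (\<lambda>t. g (of_real (r k) * cis t))"
      by (rule continuous_on_compose2[OF holomorphic_on_imp_continuous_on[OF that]]) (use cr in auto)
    then show ?thesis by (intro continuous_intros)
  qed
  have int: "integral\<^sup>L circle (s k) =
      integral\<^sup>L circle (\<lambda>t. (cmod (eval_fps ?F (of_real (r k) * cis t)))\<^sup>2) -
      integral\<^sup>L circle (\<lambda>t. (cmod (eval_fps ?P (of_real (r k) * cis t)))\<^sup>2)" for k
    unfolding s_def fps_expansion_unit_disc(2)[OF f cr] fps_expansion_unit_disc(2)[OF p cr]
    by (intro Bochner_Integration.integral_diff integrable_circle cont f p)
  have lim0: "(\<lambda>k. integral\<^sup>L circle (s k)) \<longlonglongrightarrow> integral\<^sup>L circle (\<lambda>_. 0)"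
  proof (rule integral_dominated_convergence[where w = "\<lambda>_. (C * B)\<^sup>2 + B\<^sup>2"])
    show "s k \<in> borel_measurable circle" for k
      unfolding s_def
      by (intro borel_measurable_integrable Bochner_Integration.integrable_diff integrable_circle cont f p)
    show "AE t in circle. norm (s k t) \<le> (C * B)\<^sup>2 + B\<^sup>2" for k
    proof (intro always_eventually allI)
      fix t
      have "(cmod (?f (of_real (r k) * cis t)))\<^sup>2 \<le> (C * B)\<^sup>2" "(cmod (p (of_real (r k) * cis t)))\<^sup>2 \<le> B\<^sup>2"
        by (intro power_mono fb B cr norm_ge_zero)+
      then show "norm (s k t) \<le> (C * B)\<^sup>2 + B\<^sup>2"
        unfolding s_def real_norm_def abs_le_iff
        using zero_le_power2[of "cmod (?f (of_real (r k) * cis t))"]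
          zero_le_power2[of "cmod (p (of_real (r k) * cis t))"] by linarith
    qed
    show "AE t in circle. (\<lambda>k. s k t) \<longlonglongrightarrow> 0"
      using AE
    proof eventually_elim
      fix t assume "\<exists>l. ((\<lambda>r. \<phi> (of_real r * cis t)) \<longlongrightarrow> l) (at_left 1) \<and> cmod l = 1"
      then obtain l where l: "((\<lambda>r. \<phi> (of_real r * cis t)) \<longlongrightarrow> l) (at_left 1)" "cmod l = 1" by auto
      have "(\<lambda>k. \<phi> (of_real (r k) * cis t)) \<longlonglongrightarrow> l"
        using filterlim_compose[OF l(1) r_lim] .
      then have "(\<lambda>k. ((cmod (\<phi> (of_real (r k) * cis t)))\<^sup>2 - 1)) \<longlonglongrightarrow> (cmod l)\<^sup>2 - 1"
        by (intro tendsto_intros)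
      then have lim: "(\<lambda>k. ((cmod (\<phi> (of_real (r k) * cis t)))\<^sup>2 - 1)) \<longlonglongrightarrow> 0"
        using l(2) by simp
      show "(\<lambda>k. s k t) \<longlonglongrightarrow> 0"
      proof (rule tendsto_0_le[OF lim, where K = "B\<^sup>2"], intro always_eventually allI)
        fix k
        have "s k t = ((cmod (\<phi> (of_real (r k) * cis t)))\<^sup>2 - 1) * (cmod (p (of_real (r k) * cis t)))\<^sup>2"
          by (simp add: s_def norm_mult power_mult_distrib algebra_simps)
        then show "norm (s k t) \<le> norm ((cmod (\<phi> (of_real (r k) * cis t)))\<^sup>2 - 1) * B\<^sup>2"
          by (auto simp: abs_mult intro!: mult_left_mono power_mono B cr)
      qed
    qed
  qed auto
  have "(\<lambda>k. integral\<^sup>L circle (s k)) \<longlonglongrightarrow> 2 * pi * (nrm ?F)\<^sup>2 - 2 * pi * (nrm ?P)\<^sup>2"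
    unfolding int
    by (intro tendsto_diff filterlim_compose[OF mean_tendsto_nrm r_lim] F P)
  from LIMSEQ_unique[OF this lim0] have "2 * pi * (nrm ?F)\<^sup>2 - 2 * pi * (nrm ?P)\<^sup>2 = 0"
    by simp
  then have "(nrm ?F)\<^sup>2 = (nrm ?P)\<^sup>2" by simp
  then have "nrm ?F = nrm ?P"
    using nrm_nonneg[OF F] nrm_nonneg[OF P] by simp
  then show "nrm (fps_expansion \<phi> 0 * ?P) = nrm ?P" by (simp add: mult)
qed

lemma inner_imp_isometric:
  assumes "inner_function \<phi>"
  shows "isometric (fps_expansion \<phi> 0)"
proof -
  have *: "fps_expansion \<phi> 0 * fps_cutoff N f \<in> l2 \<and>
      nrm (fps_expansion \<phi> 0 * fps_cutoff N f) = nrm (fps_cutoff N f)" for N f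
  proof -
    define p where "p = truncate_fps N f"
    have exp: "fps_expansion (poly p) 0 = fps_cutoff N f"
      by (rule fps_expansion_eqI) (auto simp: p_def simp flip: fps_of_poly_truncate)
    have hol: "poly p holomorphic_on unit_disc" by (intro holomorphic_intros)
    have "compact (poly p ` cball 0 1)"
      by (intro compact_continuous_image continuous_intros) auto
    then obtain B where "\<And>z. z \<in> cball 0 1 \<Longrightarrow> cmod (poly p z) \<le> B"
      using compact_imp_bounded bounded_iff by (metis image_eqI)
    then have B: "cmod (poly p z) \<le> B" if "cmod z < 1" for z using that by simp
    show ?thesis using nrm_mult_inner[OF assms hol B] by (simp add: exp)
  qed
  then show ?thesis by (intro isometric_if_isometric_on_polynomials) auto
qed

section \<open>The Hardy space as a space of coefficient sequences\<close>

text \<open>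
The inverse of the Taylor coefficient map from the Hardy space to \<open>l2\<close>; the value 0 off the disc
is the normalization of the Hardy space.
\<close>

definition disc_fun :: "complex fps \<Rightarrow> complex \<Rightarrow> complex" where
  "disc_fun F = (\<lambda>z. if z \<in> unit_disc then eval_fps F z else 0)"

lemma eval_fps_l2: "F \<in> l2 \<Longrightarrow> cmod z < 1 \<Longrightarrow> ereal (cmod z) < fps_conv_radius F"
  by (intro less_fps_conv_radius fps_conv_radius_l2)

lemma fps_expansion_disc_fun [simp]: "F \<in> l2 \<Longrightarrow> fps_expansion (disc_fun F) 0 = F"
  by (intro fps_expansion_eqI fps_conv_radius_l2) (auto simp: disc_fun_def)

lemma disc_fun_holomorphic: assumes "F \<in> l2" shows "disc_fun F holomorphic_on unit_disc"
proof -
  have "eval_fps F holomorphic_on unit_disc"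
    using eval_fps_l2[OF assms] by (intro holomorphic_on_eval_fps) auto
  then show ?thesis by (rule holomorphic_transform) (simp add: disc_fun_def)
qed

lemma disc_fun_H2: "F \<in> l2 \<Longrightarrow> disc_fun F \<in> H2"
  using disc_fun_holomorphic[of F] by (auto simp: H2_def taylor_coeff_def l2_def) (simp add: disc_fun_def)

lemma H2_obtain_disc_fun: assumes "f \<in> H2" obtains F where "F \<in> l2" "f = disc_fun F"
proof
  show "fps_expansion f 0 \<in> l2" using assms by (simp add: H2_def l2_def taylor_coeff_def)
  show "f = disc_fun (fps_expansion f 0)"
    using assms fps_expansion_unit_disc(2)[of f] by (auto simp: H2_def disc_fun_def)
qed

lemma H2_inner_eq_ip: "H2_inner f g = ip (fps_expansion f 0) (fps_expansion g 0)"
  by (simp add: H2_inner_def ip_def taylor_coeff_def)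

lemma H2_norm_eq_nrm: "H2_norm f = nrm (fps_expansion f 0)"
  by (simp add: H2_norm_def nrm_def taylor_coeff_def)

lemma disc_fun_add: "F \<in> l2 \<Longrightarrow> G \<in> l2 \<Longrightarrow> (\<lambda>z. disc_fun F z + disc_fun G z) = disc_fun (F + G)"
  by (auto simp: disc_fun_def fun_eq_iff eval_fps_add eval_fps_l2)

lemma disc_fun_diff: "F \<in> l2 \<Longrightarrow> G \<in> l2 \<Longrightarrow> (\<lambda>z. disc_fun F z - disc_fun G z) = disc_fun (F - G)"
  by (auto simp: disc_fun_def fun_eq_iff eval_fps_diff eval_fps_l2)

lemma disc_fun_scale: "F \<in> l2 \<Longrightarrow> (\<lambda>z. c * disc_fun F z) = disc_fun (fps_const c * F)"
  by (auto simp: disc_fun_def fun_eq_iff eval_fps_mult eval_fps_l2)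

lemma disc_fun_0: "disc_fun 0 = (\<lambda>z. 0)"
  by (auto simp: disc_fun_def)

lemma disc_fun_eq_0_iff: assumes "F \<in> l2" shows "disc_fun F = (\<lambda>z. 0) \<longleftrightarrow> F = 0"
proof
  assume "disc_fun F = (\<lambda>z. 0)"
  then have "disc_fun F = disc_fun 0" by (simp add: disc_fun_0)
  from arg_cong[OF this, of "\<lambda>f. fps_expansion f 0"] show "F = 0" using assms by simp
qed (simp add: disc_fun_0)

lemma mult_disc_fun:
  assumes "\<phi> holomorphic_on unit_disc" "F \<in> l2"
  shows "(\<lambda>z. \<phi> z * disc_fun F z) = disc_fun (fps_expansion \<phi> 0 * F)"
proof
  fix z
  show "\<phi> z * disc_fun F z = disc_fun (fps_expansion \<phi> 0 * F) z"
    using fps_expansion_unit_disc[OF assms(1)] assms(2)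
    by (cases "z \<in> unit_disc") (auto simp: disc_fun_def eval_fps_mult less_fps_conv_radius eval_fps_l2)
qed

lemma inner_holomorphic: "inner_function \<phi> \<Longrightarrow> \<phi> holomorphic_on unit_disc"
  by (simp add: inner_function_def H_infinity_def)

lemma model_space_eq:
  assumes \<phi>: "inner_function \<phi>"
  shows "model_space \<phi> = disc_fun ` model (fps_expansion \<phi> 0)"
proof -
  let ?U = "fps_expansion \<phi> 0"
  have in_iff: "disc_fun F \<in> model_space \<phi> \<longleftrightarrow> F \<in> model ?U" if F: "F \<in> l2" for F
  proof -
    have "H2_inner (disc_fun F) (\<lambda>z. \<phi> z * disc_fun G z) = ip F (?U * G)" if "G \<in> l2" for G
      using that F isometric_l2[OF inner_imp_isometric[OF \<phi>]]
      by (simp add: mult_disc_fun inner_holomorphic[OF \<phi>] H2_inner_eq_ip)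
    then show ?thesis
      using F disc_fun_H2 by (auto simp: model_space_def model_def elim!: H2_obtain_disc_fun)
  qed
  have "f \<in> H2" if "f \<in> model_space \<phi>" for f using that by (simp add: model_space_def)
  then show ?thesis
    using in_iff model_l2 by (fastforce elim!: H2_obtain_disc_fun)
qed

lemma H2_proj_disc_fun:
  assumes u: "isometric u" and F: "F \<in> l2"
  shows "H2_proj (disc_fun ` model u) (disc_fun F) = disc_fun (model_proj u F)"
  unfolding H2_proj_def
proof (rule the_equality)
  have inner: "H2_inner (\<lambda>z. disc_fun F z - disc_fun G z) (disc_fun H) = ip (F - G) H" if "G \<in> model u" "H \<in> model u" for G H
    using that F by (simp add: disc_fun_diff H2_inner_eq_ip l2_diff model_l2)
  note P = model_proj_in_model[OF u F]
  show "disc_fun (model_proj u F) \<in> disc_fun ` model u \<and>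
      (\<forall>h\<in>disc_fun ` model u. H2_inner (\<lambda>z. disc_fun F z - disc_fun (model_proj u F) z) h = 0)"
    using P model_proj_orthogonal[OF u F] by (auto simp: inner)
  fix g assume g: "g \<in> disc_fun ` model u \<and> (\<forall>h\<in>disc_fun ` model u. H2_inner (\<lambda>z. disc_fun F z - g z) h = 0)"
  then obtain G where G: "G \<in> model u" "g = disc_fun G" by auto
  have orth: "ip (F - G) H = 0" if "H \<in> model u" for H
    using g G that inner by auto
  let ?D = "model_proj u F - G"
  have D: "?D \<in> model u"
    using P G by (auto simp: model_def l2_diff ip_diff_left isometric_l2[OF u])
  have "ip ?D ?D = ip (F - G) ?D - ip (F - model_proj u F) ?D"
    using P G D F by (simp add: model_l2 l2_diff flip: ip_diff_left)
  also have "\<dots> = 0" using orth[OF D] model_proj_orthogonal[OF u F D] by simp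
  finally have "?D = 0" using D by (intro ip_self_eq_0D) (auto simp: model_l2)
  then show "g = disc_fun (model_proj u F)" using G by simp
qed

lemma truncated_Toeplitz_disc_fun:
  assumes \<phi>1: "inner_function \<phi>1" and \<phi>2: "inner_function \<phi>2" and F: "F \<in> l2"
  shows "truncated_Toeplitz \<phi>1 \<phi>2 (disc_fun F) = disc_fun (compression (fps_expansion \<phi>1 0) (fps_expansion \<phi>2 0) F)"
  using inner_imp_isometric[OF \<phi>1] inner_imp_isometric[OF \<phi>2] F
  by (simp add: truncated_Toeplitz_def compression_def model_space_eq \<phi>1
      mult_disc_fun inner_holomorphic[OF \<phi>2] H2_proj_disc_fun isometric_l2)

lemma truncated_Toeplitz_bounded:
  assumes \<phi>1: "inner_function \<phi>1" and \<phi>2: "inner_function \<phi>2"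
  shows "bounded_operator_on (model_space \<phi>1) (truncated_Toeplitz \<phi>1 \<phi>2)"
proof -
  note iso = inner_imp_isometric[OF \<phi>1] inner_imp_isometric[OF \<phi>2]
  let ?T = "compression (fps_expansion \<phi>1 0) (fps_expansion \<phi>2 0)"
  have T: "?T F \<in> l2" if "F \<in> model (fps_expansion \<phi>1 0)" for F
    using compression_in_model[OF iso] that by (auto dest: model_l2)
  show ?thesis
    unfolding bounded_operator_on_def model_space_eq[OF \<phi>1]
  proof (intro conjI)
    show "\<exists>B. \<forall>f\<in>disc_fun ` model (fps_expansion \<phi>1 0). H2_norm (truncated_Toeplitz \<phi>1 \<phi>2 f) \<le> B * H2_norm f"
      by (rule exI[of _ 1])
         (auto simp: truncated_Toeplitz_disc_fun \<phi>1 \<phi>2 model_l2 H2_norm_eq_nrm T nrm_compression_le iso)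
  qed (auto simp: truncated_Toeplitz_disc_fun \<phi>1 \<phi>2 model_l2 disc_fun_add disc_fun_scale T l2_add l2_scale
        compression_add compression_scale compression_in_model iso)
qed

lemma partial_isometry_iff:
  assumes \<phi>1: "inner_function \<phi>1" and \<phi>2: "inner_function \<phi>2"
  shows "partial_isometry_on (model_space \<phi>1) (truncated_Toeplitz \<phi>1 \<phi>2) \<longleftrightarrow>
    isometric_off_kernel (fps_expansion \<phi>1 0) (fps_expansion \<phi>2 0)"
proof -
  note iso = inner_imp_isometric[OF \<phi>1] inner_imp_isometric[OF \<phi>2]
  let ?u = "fps_expansion \<phi>1 0"
  let ?T = "compression ?u (fps_expansion \<phi>2 0)"
  have T: "?T F \<in> l2" if "F \<in> model ?u" for F
    using compression_in_model[OF iso] that by (auto dest: model_l2)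
  have "operator_kernel (model_space \<phi>1) (truncated_Toeplitz \<phi>1 \<phi>2) = disc_fun ` {k \<in> model ?u. ?T k = 0}"
    using T by (auto simp: operator_kernel_def model_space_eq truncated_Toeplitz_disc_fun \<phi>1 \<phi>2 model_l2 disc_fun_eq_0_iff disc_fun_0)
  then have kernel: "operator_kernel (disc_fun ` model ?u) (truncated_Toeplitz \<phi>1 \<phi>2) = disc_fun ` {k \<in> model ?u. ?T k = 0}"
    by (simp add: model_space_eq \<phi>1)
  have "orth_compl_in (model_space \<phi>1) (operator_kernel (model_space \<phi>1) (truncated_Toeplitz \<phi>1 \<phi>2)) =
      {f \<in> disc_fun ` model ?u. \<forall>k \<in> {k \<in> model ?u. ?T k = 0}. H2_inner f (disc_fun k) = 0}"
    by (simp add: orth_compl_in_def model_space_eq \<phi>1 kernel)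
  also have "\<dots> = disc_fun ` {f \<in> model ?u. \<forall>k \<in> {k \<in> model ?u. ?T k = 0}. H2_inner (disc_fun f) (disc_fun k) = 0}"
    by blast
  also have "{f \<in> model ?u. \<forall>k \<in> {k \<in> model ?u. ?T k = 0}. H2_inner (disc_fun f) (disc_fun k) = 0} =
      {f \<in> model ?u. \<forall>k\<in>model ?u. ?T k = 0 \<longrightarrow> ip f k = 0}"
    by (intro Collect_cong conj_cong refl) (auto simp: H2_inner_eq_ip model_l2)
  finally have "orth_compl_in (model_space \<phi>1) (operator_kernel (model_space \<phi>1) (truncated_Toeplitz \<phi>1 \<phi>2)) =
      disc_fun ` {f \<in> model ?u. \<forall>k\<in>model ?u. ?T k = 0 \<longrightarrow> ip f k = 0}" .
  then show ?thesis
    unfolding partial_isometry_on_def isometric_off_kernel_def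
    by (auto simp: truncated_Toeplitz_bounded \<phi>1 \<phi>2 truncated_Toeplitz_disc_fun model_l2 H2_norm_eq_nrm T)
qed

text \<open>
A bounded quotient has square-summable coefficients. Conversely, a quotient in \<open>l2\<close> is an isometric
multiplier, hence bounded by 1 on the disc.
\<close>

lemma inner_divides_iff:
  assumes \<phi>: "inner_function \<phi>" and \<psi>: "inner_function \<psi>"
  shows "inner_divides \<phi> \<psi> \<longleftrightarrow> (\<exists>w\<in>l2. fps_expansion \<psi> 0 = fps_expansion \<phi> 0 * w)"
proof
  assume "inner_divides \<phi> \<psi>"
  then obtain \<theta> where \<theta>: "\<theta> holomorphic_on unit_disc" "bounded (\<theta> ` unit_disc)"
      and eq: "\<And>z. z \<in> unit_disc \<Longrightarrow> \<psi> z = \<theta> z * \<phi> z"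
    by (auto simp: inner_divides_def H_infinity_def)
  obtain C where C: "\<forall>z\<in>unit_disc. cmod (\<theta> z) \<le> C"
    using \<theta>(2) by (auto simp: bounded_iff)
  have ev: "\<forall>\<^sub>F z in nhds 0. \<psi> z = \<theta> z * \<phi> z"
    using eventually_nhds_in_open[of unit_disc 0] by (auto elim!: eventually_mono intro: eq)
  have "fps_expansion \<psi> 0 = fps_expansion \<phi> 0 * fps_expansion \<theta> 0"
    unfolding fps_expansion_cong[OF ev] fps_expansion_mult[OF \<theta>(1) inner_holomorphic[OF \<phi>]]
    by (rule mult.commute)
  moreover have "fps_expansion \<theta> 0 \<in> l2"
    using C by (intro bounded_imp_l2[OF \<theta>(1), of C]) auto
  ultimately show "\<exists>w\<in>l2. fps_expansion \<psi> 0 = fps_expansion \<phi> 0 * w" by blast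
next
  assume "\<exists>w\<in>l2. fps_expansion \<psi> 0 = fps_expansion \<phi> 0 * w"
  then obtain w where w: "w \<in> l2" and eq: "fps_expansion \<psi> 0 = fps_expansion \<phi> 0 * w" by blast
  have iso: "isometric w"
    using isometric_quotient[OF inner_imp_isometric[OF \<phi>] inner_imp_isometric[OF \<psi>] eq w] .
  have "disc_fun w \<in> H_infinity"
    using disc_fun_holomorphic[OF w] isometric_eval_le_1[OF iso]
    by (auto simp: H_infinity_def bounded_iff disc_fun_def intro!: exI[of _ 1])
  moreover have "\<psi> z = disc_fun w z * \<phi> z" if "z \<in> unit_disc" for z
    using that fps_expansion_unit_disc(1)[OF inner_holomorphic[OF \<phi>]]
      fps_expansion_unit_disc(2)[OF inner_holomorphic[OF \<phi>], of z]
      fps_expansion_unit_disc(2)[OF inner_holomorphic[OF \<psi>], of z] w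
    by (simp add: eq eval_fps_mult less_fps_conv_radius eval_fps_l2 disc_fun_def mult.commute)
  ultimately show "inner_divides \<phi> \<psi>"
    by (auto simp: inner_divides_def)
qed

theorem corollary4p4:
  fixes \<phi>1 \<phi>2 :: "complex \<Rightarrow> complex"
  assumes "inner_function \<phi>1" and "\<not> \<phi>1 constant_on unit_disc"
    and "inner_function \<phi>2" and "\<not> \<phi>2 constant_on unit_disc"
  shows "partial_isometry_on (model_space \<phi>1) (truncated_Toeplitz \<phi>1 \<phi>2) \<longleftrightarrow>
           inner_divides \<phi>2 \<phi>1 \<or> inner_divides \<phi>1 \<phi>2"
  using assms(1,3)
  by (simp add: partial_isometry_iff isometric_off_kernel_iff inner_imp_isometric inner_divides_iff)

end
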